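(* Let $\mathbf P$: $\dot x=f(x,u)$, $y=g(x)$ (with $f:\mathbb R^n\times\mathbb R\to\mathbb R^n$ and $g:\mathbb R^n\to\mathbb R$ of class $C^1$) satisfy Assumption 2 (stated in the context), and assume moreover that $\mathbf P$ has well-defined backwards state trajectories for all $t<0$, corresponding to any initial state in $\mathbb R^n$ (at time $0$) and any constant input in $[u_{min},u_{max}]$. Further, assume that the closed-loop system formed by $\mathbf P$ and the saturating integrator satisfies Assumption 3 (stated in the context, with the constant $k_0>0$), and let $r\in(y_{min},y_{max})$, where $y_{min}=G(u_{min})$, $y_{max}=G(u_{max})$, $G(u)=g(\Xi(u))$. Let $u_r=G^{-1}(r)$. Let $T>0$ and define the set $X_T\subset X=\mathbb R^n\times[u_{min},u_{max}]$ as follows: $(x_0,u_0)\in X$ belongs to $X_T$ if the state trajectory $z$ of $\mathbf P$ starting from $z(0)=x_0$, with constant input $u_0$, satisfies $\|z(T)-\Xi(u_0)\|\le\varepsilon_0/2$. Then there exists $k_T\in(0,k_0]$ such that for any $k\in(0,k_T]$, if the initial state of the closed-loop system with gain $k$ and reference $r$ is in $X_T$, then the state trajectory $(x,u)$ of the closed-loop system satisfies, as $t\to\infty$, $$x(t)\to\Xi(u_r),\qquad u(t)\to u_r,\qquad y(t)\to r,$$ and this convergence is at an exponential rate, i.e., there exist $C,\omega>0$ such that $\|x(t)-\Xi(u_r)\|+|u(t)-u_r|+|y(t)-r|\le Ce^{-\omega t}$ for all $t\ge0$.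
   Context: Plant: $x(t)\in\mathbb R^n$; the input $u$ and output $y$ are scalar; $\dot x=f(x,u)$, $y=g(x)$, with $f,g$ of class $C^1$. For an interval $J$ and $\alpha>0$, $\mathrm{Lip}_\alpha(J;\mathbb R^m)$ is the set of functions $J\to\mathbb R^m$ that are Lipschitz continuous with Lipschitz constant $\alpha$. Assumption 1. There exist real numbers $u_{min}<u_{max}$, $\alpha>0$ and $\Xi\in\mathrm{Lip}_\alpha([u_{min},u_{max}];\mathbb R^n)$ such that $f(\Xi(u),u)=0$ for all $u\in[u_{min},u_{max}]$. Moreover, there exist $\varepsilon_0>0$, $\lambda>0$, $m\ge1$ such that for each constant input $u_0\in[u_{min},u_{max}]$: if $\|x(0)-\Xi(u_0)\|\le\varepsilon_0$, then $\|x(t)-\Xi(u_0)\|\le m e^{-\lambda t}\|x(0)-\Xi(u_0)\|$ for all $t\ge0$, where $x$ is the state trajectory of $\mathbf P$ with constant input $u_0$. Assumption 2. $\mathbf P$ satisfies Assumption 1 and moreover, for the function $G(u)=g(\Xi(u))$, $u\in[u_{min},u_{max}]$, there exists $\mu>0$ such that $G(u_1)-G(u_2)\ge2\mu(u_1-u_2)$ for all $u_1,u_2\in[u_{min},u_{max}]$ with $u_1>u_2$. The symbols $u_{min},u_{max},\alpha,\Xi,\varepsilon_0,\lambda,m,\mu$ refer to fixed data as in these assumptions. Saturating integrator. This is the dynamical system with state $u\in[u_{min},u_{max}]$ and scalar input $w$ given by $\dot u=\mathcal S(u,w)$, where $\mathcal S(u,w)=w^+$ if $u\le u_{min}$, $\mathcal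 S(u,w)=w$ if $u\in(u_{min},u_{max})$, $\mathcal S(u,w)=w^-$ if $u\ge u_{max}$, with $w^+=\max\{w,0\}$, $w^-=\min\{w,0\}$. For polynomial $w$ the state trajectory $u$ is the (unique) solution in the obvious sense (absolutely continuous, equation holding a.e.). For fixed $u(0)$ the state trajectories for polynomial inputs satisfy $|u_2(t)-u_1(t)|\le\|w_2-w_1\|_{L^1[0,t]}$; for a general input $w\in L^1[0,t]$, $u(t)$ is defined by continuous extension in the $L^1$ norm (polynomials being dense in $L^1[0,t]$). Closed-loop system. With gain $k\ge0$ and constant reference $r$: $\dot x=f(x,u)$, $y=g(x)$, $\dot u=\mathcal S(u,w)$, $w=k(r-y)$, where $u$ is the state trajectory of the saturating integrator with input $w$, i.e., $u(t)$ is obtained from the state trajectories for polynomial inputs with the same initial state $u(0)$ by continuous extension in the $L^1[0,t]$ norm of the input. Its state is $(x(t),u(t))$ and its state space is $X=\mathbb R^n\times[u_{min},u_{max}]$. Assumption 3. There exists $k_0>0$ such that for any $k\in[0,k_0]$ and any $r\in(y_{min},y_{max})$, the closed-loop system with gain $k$ and reference $r$ has a unique state trajectory in forward time on the interval $[0,\infty)$, for any initial state in $X$. Moreover, at any time $t\ge0$, the state $(x(t),u(t))$ depends continuously on the initial state $(x(0),u(0))$. *)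

theory Defs
  imports "HOL-Analysis.Analysis" "HOL-Computational_Algebra.Polynomial"
begin

definition C1_map :: "('a::real_normed_vector \<Rightarrow> 'b::real_normed_vector) \<Rightarrow> bool" where
  "C1_map F \<longleftrightarrow>
     (\<exists>F' :: 'a \<Rightarrow> ('a \<Rightarrow>\<^sub>L 'b).
        (\<forall>z. (F has_derivative blinfun_apply (F' z)) (at z)) \<and> continuous_on UNIV F')"

text \<open>
  Absolute continuity on a compact interval. A finite family of non-overlapping compact subintervals
  is given as a division \<open>d\<close> of its own union; a member \<open>k\<close> is the interval from \<open>Inf k\<close> to \<open>Sup k\<close>.
\<close>

definition abs_continuous_on :: "real \<Rightarrow> real \<Rightarrow> (real \<Rightarrow> real) \<Rightarrow> bool" where
  "abs_continuous_on a b v \<longleftrightarrow>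
     (\<forall>\<epsilon>>0. \<exists>\<delta>>0. \<forall>d. d division_of \<Union>d \<and> \<Union>d \<subseteq> {a..b} \<and> (\<Sum>k\<in>d. Sup k - Inf k) < \<delta> \<longrightarrow>
        (\<Sum>k\<in>d. \<bar>v (Sup k) - v (Inf k)\<bar>) < \<epsilon>)"

text \<open>
  State trajectories of the plant on the time interval \<open>J\<close>, for an input \<open>u\<close> that is continuous on \<open>J\<close>,
  so that solutions are classical (with one-sided derivatives at the end points of \<open>J\<close>).
\<close>

definition plant_traj ::
  "('s::real_normed_vector \<Rightarrow> real \<Rightarrow> 's) \<Rightarrow> real set \<Rightarrow> (real \<Rightarrow> 's) \<Rightarrow> (real \<Rightarrow> real) \<Rightarrow> bool" where
  "plant_traj f J x u \<longleftrightarrow>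
     (\<forall>t\<in>J. (x has_vector_derivative f (x t) (u t)) (at t within J))"

definition sat_rhs :: "real \<Rightarrow> real \<Rightarrow> real \<Rightarrow> real \<Rightarrow> real" where
  "sat_rhs umin umax u w =
     (if u \<le> umin then max w 0 else if u \<ge> umax then min w 0 else w)"

definition sat_poly_traj :: "real \<Rightarrow> real \<Rightarrow> real poly \<Rightarrow> (real \<Rightarrow> real) \<Rightarrow> bool" where
  "sat_poly_traj umin umax p v \<longleftrightarrow>
     (\<forall>t\<ge>0. v t \<in> {umin..umax}) \<and>
     (\<forall>t\<ge>0. abs_continuous_on 0 t v) \<and>
     (AE t in lebesgue. t > 0 \<longrightarrow>
        (v has_real_derivative sat_rhs umin umax (v t) (poly p t)) (at t))"

text \<open>
  \<open>V\<close> is a sequence of state trajectories of the saturating integrator, all with initial state \<open>u0\<close>,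
  for polynomial inputs that converge to \<open>w\<close> in the norm of \<open>L\<^sup>1[0,t]\<close>.
\<close>

definition sat_approx ::
  "real \<Rightarrow> real \<Rightarrow> real \<Rightarrow> (real \<Rightarrow> real) \<Rightarrow> real \<Rightarrow> (nat \<Rightarrow> real \<Rightarrow> real) \<Rightarrow> bool" where
  "sat_approx umin umax u0 w t V \<longleftrightarrow>
     (\<exists>P :: nat \<Rightarrow> real poly.
        (\<forall>n. sat_poly_traj umin umax (P n) (V n) \<and> V n 0 = u0) \<and>
        (\<lambda>n. LINT s:{0..t}|lebesgue. \<bar>poly (P n) s - w s\<bar>) \<longlonglongrightarrow> 0)"

text \<open>
  Continuous extension in the \<open>L\<^sup>1\<close> norm: \<open>u t\<close> is the common limit of \<open>V n t\<close> over all approximating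
  sequences. Requiring one such sequence keeps the universal part from being vacuous; the integrability
  requirement matters because Lebesgue integrals of non-integrable functions are \<open>0\<close> by convention.
\<close>

definition sat_traj :: "real \<Rightarrow> real \<Rightarrow> (real \<Rightarrow> real) \<Rightarrow> (real \<Rightarrow> real) \<Rightarrow> bool" where
  "sat_traj umin umax w u \<longleftrightarrow>
     (\<forall>t\<ge>0. w absolutely_integrable_on {0..t} \<and>
        (\<exists>V. sat_approx umin umax (u 0) w t V) \<and>
        (\<forall>V. sat_approx umin umax (u 0) w t V \<longrightarrow> (\<lambda>n. V n t) \<longlonglongrightarrow> u t))"

definition closed_loop_traj ::
  "('s::real_normed_vector \<Rightarrow> real \<Rightarrow> 's) \<Rightarrow> ('s \<Rightarrow> real) \<Rightarrow> real \<Rightarrow> real \<Rightarrow> real \<Rightarrow> real \<Rightarrow>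
     (real \<Rightarrow> 's) \<Rightarrow> (real \<Rightarrow> real) \<Rightarrow> bool" where
  "closed_loop_traj f g umin umax k r x u \<longleftrightarrow>
     plant_traj f {0..} x u \<and>
     sat_traj umin umax (\<lambda>t. k * (r - g (x t))) u"

definition assumption1 ::
  "('s::real_normed_vector \<Rightarrow> real \<Rightarrow> 's) \<Rightarrow> real \<Rightarrow> real \<Rightarrow> real \<Rightarrow> (real \<Rightarrow> 's) \<Rightarrow>
     real \<Rightarrow> real \<Rightarrow> real \<Rightarrow> bool" where
  "assumption1 f umin umax \<alpha> \<Xi> \<epsilon>0 lam m \<longleftrightarrow>
     umin < umax \<and> \<alpha> > 0 \<and> \<alpha>-lipschitz_on {umin..umax} \<Xi> \<and>
     (\<forall>u\<in>{umin..umax}. f (\<Xi> u) u = 0) \<and>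
     \<epsilon>0 > 0 \<and> lam > 0 \<and> m \<ge> 1 \<and>
     (\<forall>u0\<in>{umin..umax}. \<forall>x0. norm (x0 - \<Xi> u0) \<le> \<epsilon>0 \<longrightarrow>
        (\<exists>x. plant_traj f {0..} x (\<lambda>_. u0) \<and> x 0 = x0) \<and>
        (\<forall>x. plant_traj f {0..} x (\<lambda>_. u0) \<and> x 0 = x0 \<longrightarrow>
           (\<forall>t\<ge>0. norm (x t - \<Xi> u0) \<le> m * exp (- lam * t) * norm (x 0 - \<Xi> u0))))"

definition assumption2 ::
  "('s::real_normed_vector \<Rightarrow> real \<Rightarrow> 's) \<Rightarrow> ('s \<Rightarrow> real) \<Rightarrow> real \<Rightarrow> real \<Rightarrow> real \<Rightarrow>
     (real \<Rightarrow> 's) \<Rightarrow> real \<Rightarrow> real \<Rightarrow> real \<Rightarrow> real \<Rightarrow> bool" where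
  "assumption2 f g umin umax \<alpha> \<Xi> \<epsilon>0 lam m \<mu> \<longleftrightarrow>
     assumption1 f umin umax \<alpha> \<Xi> \<epsilon>0 lam m \<and> \<mu> > 0 \<and>
     (\<forall>u1\<in>{umin..umax}. \<forall>u2\<in>{umin..umax}. u1 > u2 \<longrightarrow>
        g (\<Xi> u1) - g (\<Xi> u2) \<ge> 2 * \<mu> * (u1 - u2))"

text \<open>
  \<open>\<phi> t z\<close> is the state at time \<open>t\<close> of the unique closed-loop trajectory with initial state \<open>z\<close>.
\<close>

definition assumption3 ::
  "('s::real_normed_vector \<Rightarrow> real \<Rightarrow> 's) \<Rightarrow> ('s \<Rightarrow> real) \<Rightarrow> real \<Rightarrow> real \<Rightarrow>
     (real \<Rightarrow> 's) \<Rightarrow> real \<Rightarrow> bool" where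
  "assumption3 f g umin umax \<Xi> k0 \<longleftrightarrow>
     k0 > 0 \<and>
     (\<forall>k\<in>{0..k0}. \<forall>r\<in>{g (\<Xi> umin)<..<g (\<Xi> umax)}.
        \<exists>\<phi> :: real \<Rightarrow> 's \<times> real \<Rightarrow> 's \<times> real.
          (\<forall>z\<in>UNIV \<times> {umin..umax}.
             closed_loop_traj f g umin umax k r (\<lambda>t. fst (\<phi> t z)) (\<lambda>t. snd (\<phi> t z)) \<and>
             \<phi> 0 z = z \<and>
             (\<forall>x u. closed_loop_traj f g umin umax k r x u \<and> (x 0, u 0) = z \<longrightarrow>
                (\<forall>t\<ge>0. (x t, u t) = \<phi> t z))) \<and>
          (\<forall>t\<ge>0. continuous_on (UNIV \<times> {umin..umax}) (\<phi> t)))"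

definition X_set ::
  "('s::real_normed_vector \<Rightarrow> real \<Rightarrow> 's) \<Rightarrow> real \<Rightarrow> real \<Rightarrow> (real \<Rightarrow> 's) \<Rightarrow> real \<Rightarrow> real \<Rightarrow>
     ('s \<times> real) set" where
  "X_set f umin umax \<Xi> \<epsilon>0 T =
     {(x0, u0). u0 \<in> {umin..umax} \<and>
        (\<exists>z. plant_traj f {0..T} z (\<lambda>_. u0) \<and> z 0 = x0 \<and> norm (z T - \<Xi> u0) \<le> \<epsilon>0 / 2)}"

end

theory Submission
  imports Defs
begin

text \<open>
  The proof freezes the input. Under a constant input \<open>w\<close> the plant is attracted to the equilibrium
  \<open>\<Xi> w\<close> at an exponential rate that does not depend on \<open>w\<close>, while for a small gain \<open>k\<close> the integrator
  moves slowly: its speed is at most \<open>k\<close> times the output error. Fix a window length \<open>\<tau>\<close> after which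
  the frozen plant has lost three quarters of its distance to the equilibrium, and measure the state
  of the closed loop by \<open>e = norm (x - \<Xi> u)\<close> and \<open>v = \<bar>u - ur\<bar>\<close>. Since the output error is bounded by a
  multiple of \<open>e + v\<close>, Gronwall's inequality (\<open>trajectory_comparison\<close>) shows that over one window the
  closed loop differs from the frozen plant by \<open>O(k) * (e + v)\<close>; this is \<open>window_linear_bounds\<close>.

  The integrator contributes a decay of \<open>v\<^sup>2\<close>: the steady-state output \<open>g (\<Xi> u)\<close> increases with slope
  at least \<open>2 * \<mu>\<close>, so the drive \<open>k * (r - g x)\<close> pulls \<open>u\<close> towards \<open>ur\<close> with strength proportional to \<open>k\<close>,
  up to an error proportional to \<open>k * e\<close> (\<open>integrator_dissipation\<close>). Sampling at the ends of the
  windows, \<open>W = v\<^sup>2 + e\<^sup>2\<close> then satisfies \<open>W (a + \<tau>) \<le> (1 - k * \<mu> * \<tau>) * W a\<close>: the \<open>e\<close>-part contracts by a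
  fixed factor, the \<open>v\<close>-part decreases by an amount of first order in \<open>k\<close>, and all couplings that could spoil this
  are of second order in \<open>k\<close> or multiply \<open>e\<^sup>2\<close> (\<open>W_decay\<close>). Iterating gives the exponential rate
  (\<open>exponential_convergence\<close>), for every trajectory that has reached the tube \<open>e \<le> \<epsilon>0\<close>.

  Trajectories starting in \<open>X_set\<close> reach the tube at time \<open>T\<close>. The frozen trajectories in question end, at
  time \<open>T\<close>, in the compact set of states within \<open>\<epsilon>0 / 2\<close> of the equilibria. Backward trajectories
  exist and depend continuously on their end points, so that a covering argument bounds
  all of them on \<open>[0, T]\<close> at once (\<open>trajectories_into_compact_set_bounded\<close>). Hence one Lipschitz constant,
  and one threshold for \<open>k\<close>, serves for all of \<open>X_set\<close> (\<open>frozen_phase\<close>).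

  The state of the integrator is given only as a limit over polynomial inputs. Two inequalities survive
  this limit and carry all that is needed of \<open>u\<close>: its increments are at most the integral of \<open>\<bar>w\<bar>\<close>,
  and the increments of \<open>(u - c)\<^sup>2\<close> are at most the integral of \<open>2 * (u - c) * w\<close> for each admissible \<open>c\<close>,
  because saturation can only move \<open>u\<close> closer to such a \<open>c\<close> than the unsaturated integrator would
  (\<open>sat_traj_Lipschitz\<close>, \<open>sat_traj_square_le\<close>).
\<close>

section \<open>Absolutely continuous functions\<close>

lemma abs_continuous_onD:
  assumes "abs_continuous_on a b v" "\<epsilon> > 0"
  shows "\<exists>\<delta>>0. \<forall>d. d division_of \<Union>d \<and> \<Union>d \<subseteq> {a..b} \<and> (\<Sum>k\<in>d. Sup k - Inf k) < \<delta> \<longrightarrow>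
        (\<Sum>k\<in>d. \<bar>v (Sup k) - v (Inf k)\<bar>) < \<epsilon>"
  using assms(1)[unfolded abs_continuous_on_def, rule_format, OF assms(2)] .

lemma abs_continuous_on_subset:
  assumes v: "abs_continuous_on a b v" and sub: "{c..e} \<subseteq> {a..b}"
  shows "abs_continuous_on c e v"
  unfolding abs_continuous_on_def
proof (intro allI impI)
  fix \<epsilon> :: real assume "\<epsilon> > 0"
  from abs_continuous_onD[OF v this] obtain \<delta> where "\<delta> > 0" and \<delta>: "\<forall>d. d division_of \<Union>d \<and> \<Union>d \<subseteq> {a..b} \<and> (\<Sum>k\<in>d. Sup k - Inf k) < \<delta>
        \<longrightarrow> (\<Sum>k\<in>d. \<bar>v (Sup k) - v (Inf k)\<bar>) < \<epsilon>"
    by (elim exE conjE) (rule that)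
  show "\<exists>\<delta>>0. \<forall>d. d division_of \<Union>d \<and> \<Union>d \<subseteq> {c..e} \<and> (\<Sum>k\<in>d. Sup k - Inf k) < \<delta>
      \<longrightarrow> (\<Sum>k\<in>d. \<bar>v (Sup k) - v (Inf k)\<bar>) < \<epsilon>"
  proof (intro exI[of _ \<delta>] conjI allI impI \<open>\<delta> > 0\<close>)
    fix d :: "real set set"
    assume "d division_of \<Union>d \<and> \<Union>d \<subseteq> {c..e} \<and> (\<Sum>k\<in>d. Sup k - Inf k) < \<delta>"
    with sub show "(\<Sum>k\<in>d. \<bar>v (Sup k) - v (Inf k)\<bar>) < \<epsilon>"
      by (intro \<delta>[rule_format] conjI) (simp_all add: order_trans[OF _ sub])
  qed
qed

lemma abs_continuous_on_Lipschitz_dominated: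
  assumes v: "abs_continuous_on a b v" and "L > 0"
    and w: "\<And>s t. \<lbrakk>s \<in> {a..b}; t \<in> {a..b}\<rbrakk> \<Longrightarrow> \<bar>w t - w s\<bar> \<le> L * \<bar>v t - v s\<bar>"
  shows "abs_continuous_on a b w"
  unfolding abs_continuous_on_def
proof (intro allI impI)
  fix e :: real assume "e > 0"
  then have "e / L > 0" using \<open>L > 0\<close> by simp
  from abs_continuous_onD[OF v this] obtain \<delta> where "\<delta> > 0" and \<delta>: "\<forall>d. d division_of \<Union>d \<and> \<Union>d \<subseteq> {a..b} \<and> (\<Sum>k\<in>d. Sup k - Inf k) < \<delta>
        \<longrightarrow> (\<Sum>k\<in>d. \<bar>v (Sup k) - v (Inf k)\<bar>) < e / L"
    by (elim exE conjE) (rule that)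
  have "(\<Sum>k\<in>d. \<bar>w (Sup k) - w (Inf k)\<bar>) < e"
    if d: "d division_of \<Union>d" "\<Union>d \<subseteq> {a..b}" "(\<Sum>k\<in>d. Sup k - Inf k) < \<delta>" for d
  proof -
    have "(\<Sum>k\<in>d. \<bar>w (Sup k) - w (Inf k)\<bar>) \<le> (\<Sum>k\<in>d. L * \<bar>v (Sup k) - v (Inf k)\<bar>)"
    proof (rule sum_mono)
      fix k assume "k \<in> d"
      then obtain p q where "k = {p..q}" "k \<noteq> {}"
        using division_ofD(3,4)[OF d(1)] by (metis box_real(2))
      moreover have "k \<subseteq> {a..b}" using d(2) \<open>k \<in> d\<close> by blast
      ultimately show "\<bar>w (Sup k) - w (Inf k)\<bar> \<le> L * \<bar>v (Sup k) - v (Inf k)\<bar>"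
        by (intro w) auto
    qed
    also have "\<dots> = L * (\<Sum>k\<in>d. \<bar>v (Sup k) - v (Inf k)\<bar>)"
      by (simp add: sum_distrib_left)
    also have "\<dots> < L * (e / L)"
      using \<delta> d \<open>L > 0\<close> by (intro mult_strict_left_mono) simp_all
    finally show ?thesis using \<open>L > 0\<close> by simp
  qed
  with \<open>\<delta> > 0\<close> show "\<exists>\<delta>>0. \<forall>d. d division_of \<Union>d \<and> \<Union>d \<subseteq> {a..b} \<and> (\<Sum>k\<in>d. Sup k - Inf k) < \<delta>
      \<longrightarrow> (\<Sum>k\<in>d. \<bar>w (Sup k) - w (Inf k)\<bar>) < e"
    by (intro exI[of _ \<delta>] conjI allI impI \<open>\<delta> > 0\<close>) (elim conjE)
qed

lemma abs_continuous_on_imp_continuous_on: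
  assumes "abs_continuous_on a b v"
  shows "continuous_on {a..b} v"
  unfolding continuous_on_iff
proof (intro ballI allI impI)
  fix x e :: real assume x: "x \<in> {a..b}" and "0 < e"
  from abs_continuous_onD[OF assms \<open>0 < e\<close>] obtain \<delta> where "\<delta> > 0" and \<delta>: "\<forall>d. d division_of \<Union>d \<and> \<Union>d \<subseteq> {a..b} \<and> (\<Sum>k\<in>d. Sup k - Inf k) < \<delta>
        \<longrightarrow> (\<Sum>k\<in>d. \<bar>v (Sup k) - v (Inf k)\<bar>) < e"
    by (elim exE conjE) (rule that)
  have *: "\<bar>v q - v p\<bar> < e" if "p \<in> {a..b}" "q \<in> {a..b}" "p \<le> q" "q - p < \<delta>" for p q
    using \<delta>[rule_format, of "{{p..q}}"] that division_of_self[of p q] by auto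
  have "dist (v x') (v x) < e" if "x' \<in> {a..b}" "dist x' x < \<delta>" for x'
    using *[of x x'] *[of x' x] x that by (cases "x \<le> x'") (auto simp: dist_real_def abs_minus_commute)
  with \<open>\<delta> > 0\<close> show "\<exists>d>0. \<forall>x'\<in>{a..b}. dist x' x < d \<longrightarrow> dist (v x') (v x) < e"
    by blast
qed

text \<open>
  The Henstock-Kurzweil form of Lebesgue's theorem. A gauge may be chosen freely on the exceptional set
  \<open>N\<close>, so intervals tagged in \<open>N\<close> can be forced into an open set of measure less than \<open>\<delta>\<close>, where absolute
  continuity makes the increments of \<open>v\<close> negligible; elsewhere the derivative controls them.
\<close>

theorem abs_continuous_on_fundamental_theorem:
  fixes v v' :: "real \<Rightarrow> real"
  assumes "a \<le> b" and v: "abs_continuous_on a b v" and N: "negligible N"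
    and deriv: "\<And>t. t \<in> {a..b} - N \<Longrightarrow> (v has_real_derivative v' t) (at t within {a..b})"
  shows "(v' has_integral (v b - v a)) {a..b}"
proof -
  \<comment> \<open>With value 0 on \<open>N\<close>, tags in \<open>N\<close> contribute nothing to the Riemann sum.\<close>
  define w where "w t = (if t \<in> N then 0 else v' t)" for t
  have "(w has_integral (v b - v a)) (cbox a b)"
    unfolding has_integral
  proof (intro allI impI)
    fix e :: real assume "e > 0"
    define e1 where "e1 = e / (2 * (b - a + 1))"
    have "e1 > 0" and e1: "e1 * (b - a) \<le> e / 2"
      using \<open>e > 0\<close> \<open>a \<le> b\<close> by (auto simp: e1_def divide_simps)
    from abs_continuous_onD[OF v half_gt_zero[OF \<open>e > 0\<close>]] obtain \<delta> where "\<delta> > 0" and \<delta>: "\<forall>d. d division_of \<Union>d \<and> \<Union>d \<subseteq> {a..b} \<and> (\<Sum>k\<in>d. Sup k - Inf k) < \<delta>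
        \<longrightarrow> (\<Sum>k\<in>d. \<bar>v (Sup k) - v (Inf k)\<bar>) < e / 2"
      by (elim exE conjE) (rule that)
    obtain U where U: "open U" "N \<subseteq> U" "U - N \<in> lmeasurable" "emeasure lebesgue (U - N) < ennreal \<delta>"
      using sets_lebesgue_outer_open[OF negligible_imp_sets[OF N] \<open>\<delta> > 0\<close>] by metis
    have UN: "U = (U - N) \<union> N" using U by auto
    have Um: "U \<in> lmeasurable"
      by (subst UN) (intro fmeasurable.Un U negligible_imp_measurable N)
    have "measure lebesgue U = measure lebesgue (U - N)"
      using U(2,3) N by (metis UN measure_Un_null_set fmeasurableD negligible_iff_null_sets)
    then have U\<delta>: "measure lebesgue U < \<delta>"
      using U(4) \<open>\<delta> > 0\<close> U(3) by (simp add: emeasure_eq_measure2 ennreal_less_iff)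
    have "\<exists>d>0. t \<in> {a..b} - N \<longrightarrow>
         (\<forall>y\<in>{a..b}. norm (y-t) < d \<longrightarrow> norm (v y - v t - v' t * (y-t)) \<le> e1 * norm (y-t))" for t
      using deriv[of t, unfolded has_field_derivative_def has_derivative_within_alt] \<open>e1 > 0\<close>
      by (cases "t \<in> {a..b} - N") (auto intro: zero_less_one)
    then obtain d where d: "\<And>x. 0 < d x"
                 "\<And>x y. \<lbrakk>x \<in> {a..b} - N; y \<in> {a..b}; norm (y-x) < d x\<rbrakk>
                        \<Longrightarrow> norm (v y - v x - v' x * (y-x)) \<le> e1 * norm (y-x)"
      by metis
    define \<gamma> where "\<gamma> x = (if x \<in> N then U else ball x (d x))" for x
    have gauge: "gauge \<gamma>"
      using U d(1) by (auto simp: gauge_def \<gamma>_def)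
    have small: "norm ((\<Sum>(x, k)\<in>p. measure lborel k *\<^sub>R w x) - (v b - v a)) < e"
      if ptag: "p tagged_division_of cbox a b" and fine: "\<gamma> fine p" for p
    proof -
      have fin: "finite p" using ptag by blast
      have ba: "b - a = (\<Sum>(x,K)\<in>p. Sup K - Inf K)" "v b - v a = (\<Sum>(x,K)\<in>p. v(Sup K) - v(Inf K))"
        using additive_tagged_division_1[where f= "\<lambda>x. x"] additive_tagged_division_1[where f= v]
              \<open>a \<le> b\<close> ptag by auto
      define pN where "pN = {z \<in> p. fst z \<in> N}"
      define D where "D = snd ` pN"
      have pNp: "pN \<subseteq> p" by (auto simp: pN_def)
      have pN_tag: "pN tagged_division_of \<Union>D"
        unfolding D_def
        using tagged_partial_division_of_Union_self tagged_partial_division_subset ptag pNp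
        by (metis tagged_division_of_def)
      have Ddiv: "D division_of \<Union>D"
        unfolding D_def using division_of_tagged_division[OF pN_tag] by (simp add: D_def)
      have DU: "\<Union>D \<subseteq> U"
        using fine by (fastforce simp: D_def pN_def \<gamma>_def fine_def)
      have Dab: "\<Union>D \<subseteq> {a..b}"
        using tagged_division_ofD(3)[OF ptag] pNp by (fastforce simp: D_def)
      have Kl: "measure lborel K = measure lebesgue K" if "K \<in> D" for K
        using division_ofD(4)[OF Ddiv that] by auto
      have "(\<Sum>K\<in>D. Sup K - Inf K) = (\<Sum>K\<in>D. measure lborel K)"
      proof (rule sum.cong[OF refl])
        fix K assume "K \<in> D"
        then obtain s t where "K = {s..t}" "K \<noteq> {}"
          using division_ofD(3,4)[OF Ddiv] by (metis box_real(2))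
        then show "Sup K - Inf K = measure lborel K" by auto
      qed
      also have "\<dots> = measure lebesgue (\<Union>D)"
        using content_division[OF Ddiv] sum.cong[OF refl, of D "measure lborel" "measure lebesgue"] Kl by simp
      also have "\<dots> \<le> measure lebesgue U"
        by (intro measure_mono_fmeasurable DU Um fmeasurableD lmeasurable_division[OF Ddiv])
      finally have "(\<Sum>K\<in>D. \<bar>v (Sup K) - v (Inf K)\<bar>) < e / 2"
        using U\<delta> by (intro \<delta>[rule_format] conjI Ddiv Dab) auto
      moreover have "(\<Sum>(x,K)\<in>pN. \<bar>v (Sup K) - v (Inf K)\<bar>) = (\<Sum>K\<in>D. \<bar>v (Sup K) - v (Inf K)\<bar>)"
      proof -
        \<comment> \<open>The empty interval is excluded since \<open>Sup {}\<close> and \<open>Inf {}\<close> are unspecified.\<close>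
        let ?h = "\<lambda>K. if K = {} then 0 else \<bar>v (Sup K) - v (Inf K)\<bar>"
        have "(\<Sum>(x,K)\<in>pN. ?h K) = (\<Sum>K\<in>D. ?h K)"
          unfolding D_def
        proof (rule sum.over_tagged_division_lemma[OF pN_tag])
          fix s t :: real assume "box s t = {}"
          then show "?h (cbox s t) = 0"
            by (cases "s = t") (auto simp: not_less)
        qed
        moreover have "(\<Sum>(x,K)\<in>pN. ?h K) = (\<Sum>(x,K)\<in>pN. \<bar>v (Sup K) - v (Inf K)\<bar>)"
          by (intro sum.cong) (auto dest: tagged_division_ofD(2)[OF pN_tag])
        moreover have "(\<Sum>K\<in>D. ?h K) = (\<Sum>K\<in>D. \<bar>v (Sup K) - v (Inf K)\<bar>)"
          using division_ofD(3)[OF Ddiv] by (intro sum.cong) auto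
        ultimately show ?thesis by simp
      qed
      ultimately have pN_small: "(\<Sum>(x,K)\<in>pN. \<bar>v (Sup K) - v (Inf K)\<bar>) < e / 2" by simp
      have "norm ((\<Sum>(x, K)\<in>p. measure lborel K *\<^sub>R w x) - (v b - v a))
          = norm (\<Sum>(x, K)\<in>p. measure lborel K * w x - (v (Sup K) - v (Inf K)))"
        unfolding ba by (simp add: sum_subtractf case_prod_unfold)
      also have "\<dots> \<le> (\<Sum>z\<in>p. (case z of (x,K) \<Rightarrow> if x \<in> N then \<bar>v (Sup K) - v (Inf K)\<bar> else 0) +
           e1 * (case z of (x,K) \<Rightarrow> Sup K - Inf K))"
      proof (rule sum_norm_le)
        fix z assume "z \<in> p"
        moreover obtain x K where z: "z = (x, K)" by (cases z)
        ultimately have xK: "(x, K) \<in> p" by simp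
        then have "x \<in> K" and Kab: "K \<subseteq> cbox a b"
          using ptag by blast+
        then obtain s t where K: "K = cbox s t"
          using ptag xK by auto
        have "s \<le> t" using \<open>x \<in> K\<close> unfolding K by auto
        then have SI: "Sup K = t" "Inf K = s" "measure lborel K = t - s" and st: "s \<in> K" "t \<in> K"
          by (auto simp: K)
        have "norm (measure lborel K * w x - (v (Sup K) - v (Inf K)))
            \<le> (if x \<in> N then \<bar>v (Sup K) - v (Inf K)\<bar> else 0) + e1 * (Sup K - Inf K)"
        proof (cases "x \<in> N")
          case True
          then show ?thesis using \<open>s \<le> t\<close> \<open>e1 > 0\<close> by (simp add: SI w_def abs_minus_commute)
        next
          case False
          have "norm (y - x) < d x" if "y \<in> K" for y
            using fine xK that False by (fastforce simp: fine_def \<gamma>_def dist_norm norm_minus_commute)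
          from this[of s] this[of t] have "norm (v s - v x - v' x * (s - x)) \<le> e1 * (x - s)"
            "norm (v t - v x - v' x * (t - x)) \<le> e1 * (t - x)"
            using d(2)[of x s] d(2)[of x t] False Kab st \<open>x \<in> K\<close> by (auto simp: K)
          then have "norm ((v t - v x - v' x * (t - x)) - (v s - v x - v' x * (s - x))) \<le> e1 * (t - x) + e1 * (x - s)"
            unfolding real_norm_def by linarith
          then show ?thesis
            using False by (simp add: SI w_def algebra_simps abs_minus_commute)
        qed
        then show "norm (case z of (x, K) \<Rightarrow> measure lborel K * w x - (v (Sup K) - v (Inf K)))
            \<le> (case z of (x,K) \<Rightarrow> if x \<in> N then \<bar>v (Sup K) - v (Inf K)\<bar> else 0) +
              e1 * (case z of (x,K) \<Rightarrow> Sup K - Inf K)"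
          by (simp add: z)
      qed
      also have "\<dots> = (\<Sum>z\<in>p. case z of (x,K) \<Rightarrow> if x \<in> N then \<bar>v (Sup K) - v (Inf K)\<bar> else 0) + e1 * (b - a)"
        unfolding sum.distrib ba(1) sum_distrib_left[symmetric] ..
      also have "(\<Sum>z\<in>p. case z of (x,K) \<Rightarrow> if x \<in> N then \<bar>v (Sup K) - v (Inf K)\<bar> else 0)
          = (\<Sum>(x,K)\<in>pN. \<bar>v (Sup K) - v (Inf K)\<bar>)"
        unfolding pN_def by (rule sum.mono_neutral_cong_right[OF fin]) (auto split: if_splits)
      also have "(\<Sum>(x,K)\<in>pN. \<bar>v (Sup K) - v (Inf K)\<bar>) + e1 * (b - a) < e" using pN_small e1 by linarith
      finally show ?thesis .
    qed
    show "\<exists>\<gamma>. gauge \<gamma> \<and> (\<forall>\<D>. \<D> tagged_division_of cbox a b \<and> \<gamma> fine \<D> \<longrightarrow>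
          norm ((\<Sum>(x, k)\<in>\<D>. measure lborel k *\<^sub>R w x) - (v b - v a)) < e)"
      by (intro exI[of _ \<gamma>] conjI allI impI gauge small) simp_all
  qed
  then have "(w has_integral (v b - v a)) {a..b}" by simp
  then show ?thesis
    by (rule has_integral_spike[OF N, rotated]) (auto simp: w_def)
qed

corollary abs_continuous_on_increment_le:
  fixes v v' q :: "real \<Rightarrow> real"
  assumes "a \<le> b" and v: "abs_continuous_on a b v" and N: "negligible N"
    and deriv: "\<And>t. t \<in> {a..b} - N \<Longrightarrow> (v has_real_derivative v' t) (at t within {a..b})"
    and le: "\<And>t. t \<in> {a..b} - N \<Longrightarrow> v' t \<le> q t" and q: "q integrable_on {a..b}"
  shows "v b - v a \<le> integral {a..b} q"
proof -
  define w where "w t = (if t \<in> N then q t else v' t)" for t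
  have "(w has_integral (v b - v a)) {a..b}"
    using \<open>a \<le> b\<close> v N by (rule abs_continuous_on_fundamental_theorem) (use deriv in \<open>auto simp: w_def\<close>)
  then show ?thesis
    by (rule has_integral_le) (use q le in \<open>auto simp: w_def\<close>)
qed

section \<open>The saturating integrator\<close>

lemma sat_poly_traj_abs_continuous:
  assumes "sat_poly_traj umin umax p v" "0 \<le> b"
  shows "abs_continuous_on 0 b v"
  using assms(1)[unfolded sat_poly_traj_def, THEN conjunct2, THEN conjunct1] assms(2) by iprover

text \<open>
  In the second estimate saturation has a favourable sign. It replaces \<open>p\<close> by a smaller value only at the
  upper bound, where \<open>v - c \<ge> 0\<close>, and by a larger value only at the lower bound, where \<open>v - c \<le> 0\<close>.
\<close>

lemma sat_poly_traj_increment_le: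
  assumes v: "sat_poly_traj umin umax p v" and ab: "0 \<le> a" "a \<le> b"
  shows "\<bar>v b - v a\<bar> \<le> integral {a..b} (\<lambda>t. \<bar>poly p t\<bar>)"
    and "c \<in> {umin..umax} \<Longrightarrow>
      (v b - c)\<^sup>2 - (v a - c)\<^sup>2 \<le> integral {a..b} (\<lambda>t. 2 * (v t - c) * poly p t)"
proof -
  have range: "v t \<in> {umin..umax}" if "t \<ge> 0" for t
    using v that by (simp add: sat_poly_traj_def)
  have ac: "abs_continuous_on a b v"
    by (rule abs_continuous_on_subset[OF sat_poly_traj_abs_continuous[OF v, of b]]) (use ab in auto)
  have cv: "continuous_on {a..b} v"
    by (rule abs_continuous_on_imp_continuous_on[OF ac])
  have cp: "continuous_on {a..b} (poly p)"
    by (intro continuous_intros)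
  have "AE t in lebesgue. t > 0 \<longrightarrow>
        (v has_real_derivative sat_rhs umin umax (v t) (poly p t)) (at t)"
    using v unfolding sat_poly_traj_def by iprover
  then obtain N0 where N0: "N0 \<in> null_sets lebesgue"
    "{t. \<not> (t > 0 \<longrightarrow> (v has_real_derivative sat_rhs umin umax (v t) (poly p t)) (at t))} \<subseteq> N0"
    unfolding eventually_ae_filter by auto
  define N where "N = insert 0 N0"
  have N: "negligible N"
    using N0(1) by (simp add: N_def negligible_iff_null_sets[symmetric])
  have deriv: "(v has_real_derivative sat_rhs umin umax (v t) (poly p t)) (at t within {a..b})"
    if "t \<in> {a..b} - N" for t
  proof -
    have "t \<notin> N0" "t > 0" using that ab by (auto simp: N_def less_le)
    with N0(2) have "(v has_real_derivative sat_rhs umin umax (v t) (poly p t)) (at t)"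
      by blast
    then show ?thesis by (rule has_field_derivative_at_within)
  qed
  have absp: "(\<lambda>t. \<bar>poly p t\<bar>) integrable_on {a..b}"
    by (intro integrable_continuous_real continuous_intros cp)
  have "v b - v a \<le> integral {a..b} (\<lambda>t. \<bar>poly p t\<bar>)"
    using \<open>a \<le> b\<close> ac N deriv
    by (rule abs_continuous_on_increment_le) (auto simp: sat_rhs_def absp)
  moreover have "(- v b) - (- v a) \<le> integral {a..b} (\<lambda>t. \<bar>poly p t\<bar>)"
  proof (rule abs_continuous_on_increment_le[OF \<open>a \<le> b\<close> _ N])
    show "abs_continuous_on a b (\<lambda>t. - v t)"
      by (rule abs_continuous_on_Lipschitz_dominated[OF ac zero_less_one]) auto
    show "((\<lambda>t. - v t) has_real_derivative - sat_rhs umin umax (v t) (poly p t)) (at t within {a..b})"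
      if "t \<in> {a..b} - N" for t
      using deriv[OF that] by (rule DERIV_minus)
  qed (auto simp: sat_rhs_def absp)
  ultimately show "\<bar>v b - v a\<bar> \<le> integral {a..b} (\<lambda>t. \<bar>poly p t\<bar>)" by linarith
  show "(v b - c)\<^sup>2 - (v a - c)\<^sup>2 \<le> integral {a..b} (\<lambda>t. 2 * (v t - c) * poly p t)"
    if c: "c \<in> {umin..umax}"
  proof (rule abs_continuous_on_increment_le[OF \<open>a \<le> b\<close> _ N])
    show "abs_continuous_on a b (\<lambda>t. (v t - c)\<^sup>2)"
    proof (rule abs_continuous_on_Lipschitz_dominated[OF ac])
      show "0 < 2 * (umax - umin) + 1" using c by auto
      fix s t assume "s \<in> {a..b}" "t \<in> {a..b}"
      then have r: "v s \<in> {umin..umax}" "v t \<in> {umin..umax}"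
        using range ab by auto
      have "\<bar>(v t - c)\<^sup>2 - (v s - c)\<^sup>2\<bar> = \<bar>(v t - c) + (v s - c)\<bar> * \<bar>v t - v s\<bar>"
        by (simp add: abs_mult[symmetric] power2_eq_square algebra_simps)
      also have "\<dots> \<le> (2 * (umax - umin) + 1) * \<bar>v t - v s\<bar>"
        using r c by (intro mult_right_mono) auto
      finally show "\<bar>(v t - c)\<^sup>2 - (v s - c)\<^sup>2\<bar> \<le> (2 * (umax - umin) + 1) * \<bar>v t - v s\<bar>" .
    qed
    show "((\<lambda>t. (v t - c)\<^sup>2) has_real_derivative 2 * (v t - c) * sat_rhs umin umax (v t) (poly p t))
        (at t within {a..b})" if "t \<in> {a..b} - N" for t
      by (rule derivative_eq_intros deriv[OF that] refl)+ simp
    show "2 * (v t - c) * sat_rhs umin umax (v t) (poly p t) \<le> 2 * (v t - c) * poly p t"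
      if "t \<in> {a..b} - N" for t
    proof -
      have "v t \<in> {umin..umax}" using range that ab by auto
      then show ?thesis
        using c by (auto simp: sat_rhs_def mult_left_mono mult_left_mono_neg)
    qed
    show "(\<lambda>t. 2 * (v t - c) * poly p t) integrable_on {a..b}"
      by (intro integrable_continuous_real continuous_intros cp cv)
  qed
qed

text \<open>
  The definition provides approximating inputs separately for each final time. Convergence in
  \<open>L\<^sup>1[0,b]\<close> implies convergence in \<open>L\<^sup>1[0,s]\<close> for \<open>s \<le> b\<close>, so a single sequence works for all times up
  to \<open>b\<close>. This is what allows increments of \<open>u\<close> between two times to be estimated.
\<close>

lemma sat_traj_approximation:
  assumes u: "sat_traj umin umax w u" and w: "continuous_on {0..} w" and "0 \<le> b"
  obtains P V where "\<forall>n. sat_poly_traj umin umax (P n) (V n)"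
    and "\<forall>s\<in>{0..b}. (\<lambda>n. V n s) \<longlonglongrightarrow> u s"
    and "(\<lambda>n. integral {0..b} (\<lambda>s. \<bar>poly (P n) s - w s\<bar>)) \<longlonglongrightarrow> 0"
proof -
  obtain P V where PV: "\<And>n. sat_poly_traj umin umax (P n) (V n)" "\<And>n. V n 0 = u 0"
    and lim: "(\<lambda>n. LINT s:{0..b}|lebesgue. \<bar>poly (P n) s - w s\<bar>) \<longlonglongrightarrow> 0"
    using u \<open>0 \<le> b\<close> unfolding sat_traj_def sat_approx_def by blast
  have cont: "continuous_on {0..s} (\<lambda>s. \<bar>poly (P n) s - w s\<bar>)" for n s
    by (intro continuous_intros continuous_on_subset[OF w]) auto
  have eq: "(LINT s:{0..s}|lebesgue. \<bar>poly (P n) s - w s\<bar>) = integral {0..s} (\<lambda>s. \<bar>poly (P n) s - w s\<bar>)" for n s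
    by (intro set_lebesgue_integral_eq_integral absolutely_integrable_continuous_real cont)
  have int: "(\<lambda>s. \<bar>poly (P n) s - w s\<bar>) integrable_on {0..s}" for n s
    by (intro integrable_continuous_real cont)
  have "(\<lambda>n. V n s) \<longlonglongrightarrow> u s" if s: "s \<in> {0..b}" for s
  proof -
    have "(\<lambda>n. integral {0..s} (\<lambda>s. \<bar>poly (P n) s - w s\<bar>)) \<longlonglongrightarrow> 0"
    proof (rule tendsto_sandwich[OF _ _ tendsto_const lim[unfolded eq]])
      show "\<forall>\<^sub>F n in sequentially. 0 \<le> integral {0..s} (\<lambda>s. \<bar>poly (P n) s - w s\<bar>)"
        by (intro always_eventually allI Henstock_Kurzweil_Integration.integral_nonneg int) auto
      show "\<forall>\<^sub>F n in sequentially. integral {0..s} (\<lambda>s. \<bar>poly (P n) s - w s\<bar>)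
          \<le> integral {0..b} (\<lambda>s. \<bar>poly (P n) s - w s\<bar>)"
        using s by (intro always_eventually allI integral_subset_le int) auto
    qed
    then have "sat_approx umin umax (u 0) w s V"
      unfolding sat_approx_def eq[symmetric] by (intro exI[of _ P] conjI allI PV)
    moreover have "0 \<le> s" using s by simp
    ultimately show ?thesis
      using u unfolding sat_traj_def by iprover
  qed
  then show thesis
    using PV(1) lim[unfolded eq] by (intro that allI ballI)
qed

lemma sat_traj_range:
  assumes u: "sat_traj umin umax w u" and w: "continuous_on {0..} w" and "0 \<le> t"
  shows "u t \<in> {umin..umax}"
proof -
  obtain P V where PV: "\<forall>n. sat_poly_traj umin umax (P n) (V n)"
    "\<forall>s\<in>{0..t}. (\<lambda>n. V n s) \<longlonglongrightarrow> u s"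
    "(\<lambda>n. integral {0..t} (\<lambda>s. \<bar>poly (P n) s - w s\<bar>)) \<longlonglongrightarrow> 0"
    by (rule sat_traj_approximation[OF assms])
  have lim: "(\<lambda>n. V n t) \<longlonglongrightarrow> u t" using PV(2)[rule_format, of t] \<open>0 \<le> t\<close> by simp
  have "V n t \<in> {umin..umax}" for n
    using PV(1) \<open>0 \<le> t\<close> by (simp add: sat_poly_traj_def)
  then show ?thesis
    by (rule closed_sequentially[OF closed_atLeastAtMost _ lim])
qed

lemma sat_traj_increment_le:
  assumes u: "sat_traj umin umax w u" and w: "continuous_on {0..} w" and ab: "0 \<le> a" "a \<le> b"
  shows "\<bar>u b - u a\<bar> \<le> integral {a..b} (\<lambda>t. \<bar>w t\<bar>)"
proof -
  obtain P V where PV: "\<forall>n. sat_poly_traj umin umax (P n) (V n)"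
    "\<forall>s\<in>{0..b}. (\<lambda>n. V n s) \<longlonglongrightarrow> u s"
    and lim: "(\<lambda>n. integral {0..b} (\<lambda>s. \<bar>poly (P n) s - w s\<bar>)) \<longlonglongrightarrow> 0"
    by (rule sat_traj_approximation[OF u w order_trans[OF ab]])
  have wab: "continuous_on {s..b} w" if "0 \<le> s" for s
    by (rule continuous_on_subset[OF w]) (use that in auto)
  have bound: "\<bar>V n b - V n a\<bar> \<le> integral {a..b} (\<lambda>t. \<bar>w t\<bar>) + integral {0..b} (\<lambda>s. \<bar>poly (P n) s - w s\<bar>)" for n
  proof -
    have "\<bar>V n b - V n a\<bar> \<le> integral {a..b} (\<lambda>t. \<bar>poly (P n) t\<bar>)"
      by (rule sat_poly_traj_increment_le(1)[OF PV(1)[rule_format] ab])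
    also have "\<dots> \<le> integral {a..b} (\<lambda>t. \<bar>w t\<bar> + \<bar>poly (P n) t - w t\<bar>)"
      by (intro integral_le integrable_continuous_real continuous_intros wab ab) auto
    also have "\<dots> = integral {a..b} (\<lambda>t. \<bar>w t\<bar>) + integral {a..b} (\<lambda>t. \<bar>poly (P n) t - w t\<bar>)"
      by (intro integral_add integrable_continuous_real continuous_intros wab ab)
    also have "integral {a..b} (\<lambda>t. \<bar>poly (P n) t - w t\<bar>) \<le> integral {0..b} (\<lambda>t. \<bar>poly (P n) t - w t\<bar>)"
      using ab by (intro integral_subset_le integrable_continuous_real continuous_intros wab) auto
    finally show ?thesis by simp
  qed
  have "(\<lambda>n. \<bar>V n b - V n a\<bar>) \<longlonglongrightarrow> \<bar>u b - u a\<bar>"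
    using ab by (intro tendsto_intros PV(2)[rule_format]) auto
  moreover have "(\<lambda>n. integral {a..b} (\<lambda>t. \<bar>w t\<bar>) + integral {0..b} (\<lambda>s. \<bar>poly (P n) s - w s\<bar>))
      \<longlonglongrightarrow> integral {a..b} (\<lambda>t. \<bar>w t\<bar>) + 0"
    by (intro tendsto_intros lim)
  ultimately show ?thesis
    using bound by (intro LIMSEQ_le) auto
qed

lemma sat_traj_Lipschitz:
  assumes u: "sat_traj umin umax w u" and w: "continuous_on {0..} w" and ab: "0 \<le> a" "a \<le> b"
    and B: "\<And>t. t \<in> {a..b} \<Longrightarrow> \<bar>w t\<bar> \<le> B"
  shows "\<bar>u b - u a\<bar> \<le> B * (b - a)"
proof -
  have "\<bar>u b - u a\<bar> \<le> integral {a..b} (\<lambda>t. \<bar>w t\<bar>)"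
    by (rule sat_traj_increment_le[OF u w ab])
  also have "\<dots> \<le> integral {a..b} (\<lambda>t. B)"
    by (intro integral_le integrable_continuous_real continuous_intros continuous_on_subset[OF w] B)
      (use ab in auto)
  finally show ?thesis using ab by (simp add: mult.commute)
qed

lemma sat_traj_continuous_on:
  assumes u: "sat_traj umin umax w u" and w: "continuous_on {0..} w" and "0 \<le> a"
  shows "continuous_on {a..b} u"
proof -
  have "continuous_on {a..b} w"
    using \<open>0 \<le> a\<close> by (intro continuous_on_subset[OF w]) auto
  then have "bounded (w ` {a..b})"
    by (intro compact_imp_bounded compact_continuous_image) auto
  then obtain B where B: "\<forall>t\<in>{a..b}. \<bar>w t\<bar> \<le> B"
    by (auto simp: bounded_iff)
  have "\<bar>u t - u s\<bar> \<le> \<bar>B\<bar> * \<bar>t - s\<bar>" if "s \<in> {a..b}" "t \<in> {a..b}" "s \<le> t" for s t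
  proof -
    have "\<bar>u t - u s\<bar> \<le> B * (t - s)"
      using that \<open>0 \<le> a\<close> by (intro sat_traj_Lipschitz[OF u w] B[rule_format]) auto
    also have "\<dots> \<le> \<bar>B\<bar> * \<bar>t - s\<bar>" using that by (intro mult_mono) auto
    finally show ?thesis .
  qed
  then have "\<bar>B\<bar>-lipschitz_on {a..b} u"
    unfolding lipschitz_on_def dist_real_def by (metis abs_ge_zero abs_minus_commute linear)
  then show ?thesis by (rule lipschitz_on_continuous_on)
qed

text \<open>
  In the limit of the integrals of \<open>2 * (V n - c) * P n\<close>, both factors vary. The bound on \<open>V n - c\<close> allows
  replacing \<open>P n\<close> by \<open>w\<close> at the cost of the \<open>L\<^sup>1\<close> distance; then dominated convergence applies to \<open>V n\<close>.
\<close>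

lemma sat_traj_square_increment_le:
  assumes u: "sat_traj umin umax w u" and w: "continuous_on {0..} w" and ab: "0 \<le> a" "a \<le> b"
    and c: "c \<in> {umin..umax}"
  shows "(u b - c)\<^sup>2 - (u a - c)\<^sup>2 \<le> integral {a..b} (\<lambda>t. 2 * (u t - c) * w t)"
proof -
  obtain P V where PV: "\<forall>n. sat_poly_traj umin umax (P n) (V n)"
    "\<forall>s\<in>{0..b}. (\<lambda>n. V n s) \<longlonglongrightarrow> u s"
    and lim: "(\<lambda>n. integral {0..b} (\<lambda>s. \<bar>poly (P n) s - w s\<bar>)) \<longlonglongrightarrow> 0"
    by (rule sat_traj_approximation[OF u w order_trans[OF ab]])
  have wab: "continuous_on {s..b} w" if "0 \<le> s" for s
    by (rule continuous_on_subset[OF w]) (use that in auto)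
  have V_cont: "continuous_on {a..b} (V n)" for n
    by (rule continuous_on_subset[OF abs_continuous_on_imp_continuous_on])
      (use sat_poly_traj_abs_continuous[OF PV(1)[rule_format], of b] ab in auto)
  define D where "D = umax - umin"
  have VD: "\<bar>V n t - c\<bar> \<le> D" if "t \<ge> 0" for n t
  proof -
    have "V n t \<in> {umin..umax}" using PV(1)[rule_format, of n] that by (simp add: sat_poly_traj_def)
    then show ?thesis using c by (auto simp: D_def)
  qed
  have bound: "(V n b - c)\<^sup>2 - (V n a - c)\<^sup>2 \<le> integral {a..b} (\<lambda>t. 2 * (V n t - c) * w t)
      + 2 * D * integral {0..b} (\<lambda>s. \<bar>poly (P n) s - w s\<bar>)" for n
  proof -
    have "(V n b - c)\<^sup>2 - (V n a - c)\<^sup>2 \<le> integral {a..b} (\<lambda>t. 2 * (V n t - c) * poly (P n) t)"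
      by (rule sat_poly_traj_increment_le(2)[OF PV(1)[rule_format] ab c])
    also have "\<dots> \<le> integral {a..b} (\<lambda>t. 2 * (V n t - c) * w t + 2 * D * \<bar>poly (P n) t - w t\<bar>)"
    proof (intro integral_le integrable_continuous_real continuous_intros wab ab V_cont)
      fix t assume "t \<in> {a..b}"
      then have "\<bar>(V n t - c) * (poly (P n) t - w t)\<bar> \<le> D * \<bar>poly (P n) t - w t\<bar>"
        unfolding abs_mult using VD ab by (intro mult_right_mono) auto
      then show "2 * (V n t - c) * poly (P n) t \<le> 2 * (V n t - c) * w t + 2 * D * \<bar>poly (P n) t - w t\<bar>"
        by (simp add: algebra_simps abs_le_iff)
    qed
    also have "\<dots> = integral {a..b} (\<lambda>t. 2 * (V n t - c) * w t) + integral {a..b} (\<lambda>t. 2 * D * \<bar>poly (P n) t - w t\<bar>)"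
      by (intro integral_add integrable_continuous_real continuous_intros wab ab V_cont)
    also have "integral {a..b} (\<lambda>t. 2 * D * \<bar>poly (P n) t - w t\<bar>) = 2 * D * integral {a..b} (\<lambda>t. \<bar>poly (P n) t - w t\<bar>)"
      by simp
    also have "integral {a..b} (\<lambda>t. \<bar>poly (P n) t - w t\<bar>) \<le> integral {0..b} (\<lambda>t. \<bar>poly (P n) t - w t\<bar>)"
      using ab by (intro integral_subset_le integrable_continuous_real continuous_intros wab) auto
    finally show ?thesis using c by (simp add: D_def mult_left_mono)
  qed
  have "(\<lambda>n. integral {a..b} (\<lambda>t. 2 * (V n t - c) * w t)) \<longlonglongrightarrow> integral {a..b} (\<lambda>t. 2 * (u t - c) * w t)"
  proof (rule dominated_convergence(2)[where h = "\<lambda>t. 2 * D * \<bar>w t\<bar>"])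
    show "(\<lambda>t. 2 * (V n t - c) * w t) integrable_on {a..b}" for n
      by (intro integrable_continuous_real continuous_intros wab ab V_cont)
    show "(\<lambda>t. 2 * D * \<bar>w t\<bar>) integrable_on {a..b}"
      by (intro integrable_continuous_real continuous_intros wab ab)
    show "norm (2 * (V n t - c) * w t) \<le> 2 * D * \<bar>w t\<bar>" if "t \<in> {a..b}" for n t
      using VD[of t n] that ab by (simp add: abs_mult mult_right_mono)
    show "(\<lambda>n. 2 * (V n t - c) * w t) \<longlonglongrightarrow> 2 * (u t - c) * w t" if "t \<in> {a..b}" for t
      using that ab by (intro tendsto_intros PV(2)[rule_format]) auto
  qed
  then have "(\<lambda>n. integral {a..b} (\<lambda>t. 2 * (V n t - c) * w t)
      + 2 * D * integral {0..b} (\<lambda>s. \<bar>poly (P n) s - w s\<bar>))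
      \<longlonglongrightarrow> integral {a..b} (\<lambda>t. 2 * (u t - c) * w t) + 2 * D * 0"
    by (intro tendsto_intros lim)
  moreover have "(\<lambda>n. (V n b - c)\<^sup>2 - (V n a - c)\<^sup>2) \<longlonglongrightarrow> (u b - c)\<^sup>2 - (u a - c)\<^sup>2"
    using ab by (intro tendsto_intros PV(2)[rule_format]) auto
  ultimately show ?thesis
    using bound by (intro LIMSEQ_le) auto
qed

lemma sat_traj_square_le:
  assumes u: "sat_traj umin umax w u" and w: "continuous_on {0..} w" and ab: "0 \<le> a" "a \<le> b"
    and c: "c \<in> {umin..umax}" and B: "\<And>t. t \<in> {a..b} \<Longrightarrow> 2 * (u t - c) * w t \<le> B"
  shows "(u b - c)\<^sup>2 \<le> (u a - c)\<^sup>2 + B * (b - a)"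
proof -
  have "(u b - c)\<^sup>2 - (u a - c)\<^sup>2 \<le> integral {a..b} (\<lambda>t. 2 * (u t - c) * w t)"
    by (rule sat_traj_square_increment_le[OF u w ab c])
  also have "\<dots> \<le> integral {a..b} (\<lambda>t. B)"
    by (intro integral_le integrable_continuous_real continuous_intros B
        sat_traj_continuous_on[OF u w] continuous_on_subset[OF w])
      (use ab in auto)
  finally show ?thesis using ab by (simp add: mult.commute)
qed

section \<open>Comparison of trajectories\<close>

lemma C1_map_Lipschitz_on_compact_convex:
  assumes F: "C1_map F" and S: "compact S" "convex S"
  obtains L where "L > 0" "L-lipschitz_on S F"
proof -
  obtain F' where F': "\<forall>z. (F has_derivative blinfun_apply (F' z)) (at z)" "continuous_on UNIV F'"
    using F unfolding C1_map_def by (elim exE conjE) (rule that)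
  have "bounded (F' ` S)"
    by (intro compact_imp_bounded compact_continuous_image S continuous_on_subset[OF F'(2)]) simp
  then obtain B where B: "\<forall>y\<in>F' ` S. norm y \<le> B"
    unfolding bounded_iff by (elim exE) (rule that)
  have "(\<bar>B\<bar> + 1)-lipschitz_on S F"
  proof (rule lipschitz_onI)
    fix p q assume pq: "p \<in> S" "q \<in> S"
    have "norm (F p - F q) \<le> B * norm (p - q)"
    proof (rule differentiable_bound[OF S(2) _ _ pq])
      show "(F has_derivative blinfun_apply (F' z)) (at z within S)" for z
        using F'(1)[rule_format] by (rule has_derivative_at_withinI)
      show "onorm (blinfun_apply (F' z)) \<le> B" if "z \<in> S" for z
        using B that by (simp add: norm_blinfun.rep_eq)
    qed
    also have "\<dots> \<le> (\<bar>B\<bar> + 1) * norm (p - q)" by (intro mult_right_mono) auto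
    finally show "dist (F p) (F q) \<le> (\<bar>B\<bar> + 1) * dist p q" by (simp add: dist_norm)
  qed simp
  then show thesis by (intro that[of "\<bar>B\<bar> + 1"]) auto
qed

lemma vector_field_Lipschitz:
  fixes f :: "'a::euclidean_space \<Rightarrow> real \<Rightarrow> 'a"
  assumes "C1_map (\<lambda>(x, u). f x u)"
  obtains L where "L > 0"
    "\<forall>p q s t. norm p \<le> R \<and> norm q \<le> R \<and> s \<in> {a..b} \<and> t \<in> {a..b} \<longrightarrow>
       norm (f p s - f q t) \<le> L * (norm (p - q) + \<bar>s - t\<bar>)"
proof -
  obtain L where L: "L > 0" "L-lipschitz_on (cball 0 R \<times> {a..b}) (\<lambda>(x, u). f x u)"
    by (rule C1_map_Lipschitz_on_compact_convex[OF assms, of "cball 0 R \<times> {a..b}"])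
      (auto intro: compact_Times convex_Times)
  have "norm (f p s - f q t) \<le> L * (norm (p - q) + \<bar>s - t\<bar>)"
    if "norm p \<le> R" "norm q \<le> R" "s \<in> {a..b}" "t \<in> {a..b}" for p q s t
  proof -
    have "norm (f p s - f q t) \<le> L * dist (p, s) (q, t)"
      using lipschitz_onD[OF L(2), of "(p, s)" "(q, t)"] that by (simp add: dist_norm)
    also have "dist (p, s) (q, t) \<le> norm (p - q) + \<bar>s - t\<bar>"
      unfolding dist_prod_def using sqrt_sum_squares_le_sum[of "norm (p - q)" "\<bar>s - t\<bar>"]
      by (simp add: dist_norm)
    finally show ?thesis using \<open>L > 0\<close> by simp
  qed
  then show thesis by (intro that[OF \<open>L > 0\<close>]) blast
qed

lemma plant_traj_subset:
  "plant_traj f J x u \<Longrightarrow> I \<subseteq> J \<Longrightarrow> plant_traj f I x u"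
  unfolding plant_traj_def by (meson has_vector_derivative_within_subset subsetD)

lemma plant_traj_continuous_on: "plant_traj f J x u \<Longrightarrow> continuous_on J x"
  unfolding plant_traj_def continuous_on_eq_continuous_within
  by (blast intro: has_vector_derivative_continuous)

text \<open>
  Used with \<open>\<sigma> = 1\<close> for time shifts and with \<open>\<sigma> = -1\<close> for time reversal.
\<close>

lemma plant_traj_affine:
  assumes x: "plant_traj f J x (\<lambda>_. u0)" and I: "\<And>t. t \<in> I \<Longrightarrow> \<sigma> * t + c \<in> J"
  shows "plant_traj (\<lambda>y w. \<sigma> *\<^sub>R f y w) I (\<lambda>t. x (\<sigma> * t + c)) (\<lambda>_. u0)"
  unfolding plant_traj_def
proof
  fix t assume t: "t \<in> I"
  have "((\<lambda>t. \<sigma> * t + c) has_vector_derivative \<sigma>) (at t within I)"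
    by (auto intro!: derivative_eq_intros simp: has_real_derivative_iff_has_vector_derivative[symmetric])
  moreover have "(x has_vector_derivative f (x (\<sigma> * t + c)) u0) (at (\<sigma> * t + c) within (\<lambda>t. \<sigma> * t + c) ` I)"
    by (rule has_vector_derivative_within_subset[of _ _ _ J])
      (use x I t in \<open>auto simp: plant_traj_def\<close>)
  ultimately show "((\<lambda>t. x (\<sigma> * t + c)) has_vector_derivative \<sigma> *\<^sub>R f (x (\<sigma> * t + c)) u0) (at t within I)"
    using vector_diff_chain_within by (fastforce simp: o_def)
qed

text \<open>
  A Gronwall estimate without integrals: for \<open>p = (norm (x - z))\<^sup>2\<close>, Young's inequality gives
  \<open>p' \<le> 3 * L * (p + \<delta>\<^sup>2)\<close>, so \<open>(p + \<delta>\<^sup>2) * exp (- 3 * L * t)\<close> decreases. The squared norm is used because it is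
  differentiable everywhere.
  The rate 2 in the conclusion is a convenient integer bound for 3/2.
\<close>

lemma trajectory_distance_bound:
  fixes F :: "'a::real_inner \<Rightarrow> real \<Rightarrow> 'a"
  assumes x: "plant_traj F {a..b} x u" and z: "plant_traj F {a..b} z v"
    and Lip: "\<And>t. t \<in> {a..b} \<Longrightarrow> norm (F (x t) (u t) - F (z t) (v t)) \<le> L * (norm (x t - z t) + \<delta>)"
    and "0 \<le> L" "0 \<le> \<delta>" and d: "norm (x a - z a) \<le> d" and t: "t \<in> {a..b}"
  shows "norm (x t - z t) \<le> (d + \<delta>) * exp (2 * L * (b - a))"
proof -
  define p where "p s = (x s - z s) \<bullet> (x s - z s)" for s
  define p' where "p' s = 2 * ((x s - z s) \<bullet> (F (x s) (u s) - F (z s) (v s)))" for s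
  define h where "h s = (p s + \<delta>\<^sup>2) * exp (- 3 * L * (s - a))" for s
  have dx: "(x has_vector_derivative F (x s) (u s)) (at s within {a..b})"
    and dz: "(z has_vector_derivative F (z s) (v s)) (at s within {a..b})" if "s \<in> {a..b}" for s
    using x z that by (auto simp: plant_traj_def)
  have p': "(p has_real_derivative p' s) (at s within {a..b})" if "s \<in> {a..b}" for s
  proof -
    have "((\<lambda>s. x s - z s) has_derivative (\<lambda>h. h *\<^sub>R (F (x s) (u s) - F (z s) (v s)))) (at s within {a..b})"
      using has_vector_derivative_diff[OF dx[OF that] dz[OF that]] by (simp add: has_vector_derivative_def)
    from has_derivative_inner[OF this this] show ?thesis
      unfolding p_def p'_def has_field_derivative_def
      by (rule has_derivative_eq_rhs) (simp add: fun_eq_iff inner_commute algebra_simps)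
  qed
  have h': "(h has_real_derivative (p' s - 3 * L * (p s + \<delta>\<^sup>2)) * exp (- 3 * L * (s - a))) (at s within {a..b})"
    if "s \<in> {a..b}" for s
    unfolding h_def by (rule derivative_eq_intros p'[OF that] refl)+ (simp add: algebra_simps)
  have neg: "p' s \<le> 3 * L * (p s + \<delta>\<^sup>2)" if "s \<in> {a..b}" for s
  proof -
    define n where "n = norm (x s - z s)"
    have "p' s \<le> 2 * (n * norm (F (x s) (u s) - F (z s) (v s)))"
      unfolding p'_def n_def by (intro mult_left_mono norm_cauchy_schwarz) auto
    also have "\<dots> \<le> 2 * (n * (L * (n + \<delta>)))"
      using Lip[OF that] unfolding n_def by (intro mult_left_mono) auto
    also have "\<dots> = L * (2 * n\<^sup>2 + 2 * n * \<delta>)" by (simp add: power2_eq_square algebra_simps)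
    also have "\<dots> \<le> L * (3 * (n\<^sup>2 + \<delta>\<^sup>2))"
    proof (rule mult_left_mono[OF _ \<open>0 \<le> L\<close>])
      have "0 \<le> (n - \<delta>)\<^sup>2" by simp
      then have "2 * n * \<delta> \<le> n\<^sup>2 + \<delta>\<^sup>2" by (simp add: power2_diff)
      moreover have "0 \<le> \<delta>\<^sup>2" by simp
      ultimately show "2 * n\<^sup>2 + 2 * n * \<delta> \<le> 3 * (n\<^sup>2 + \<delta>\<^sup>2)"
        unfolding distrib_left by linarith
    qed
    finally show ?thesis by (simp add: p_def n_def power2_norm_eq_inner algebra_simps)
  qed
  have "h t \<le> h a"
  proof (cases "a = t")
    case False
    then have at: "a < t" using t by simp
    show ?thesis
    proof (rule DERIV_nonpos_imp_decreasing_open[OF less_imp_le[OF at]])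
      fix s assume s: "a < s" "s < t"
      then have "(h has_real_derivative (p' s - 3 * L * (p s + \<delta>\<^sup>2)) * exp (- 3 * L * (s - a))) (at s)"
        using h'[of s] t at_within_Icc_at[of a s b] by simp
      moreover have "(p' s - 3 * L * (p s + \<delta>\<^sup>2)) * exp (- 3 * L * (s - a)) \<le> 0"
        using neg[of s] s t by (intro mult_nonpos_nonneg) auto
      ultimately show "\<exists>y. (h has_real_derivative y) (at s) \<and> y \<le> 0" by blast
    next
      have "continuous_on {a..b} h"
        using h' by (rule DERIV_continuous_on)
      then show "continuous_on {a..t} h"
        by (rule continuous_on_subset) (use t in auto)
    qed
  qed simp
  then have "h t * exp (3 * L * (t - a)) \<le> h a * exp (3 * L * (t - a))"
    by (intro mult_right_mono) auto
  then have "p t + \<delta>\<^sup>2 \<le> (p a + \<delta>\<^sup>2) * exp (3 * L * (t - a))"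
    by (simp add: h_def mult.assoc exp_add[symmetric])
  also have "\<dots> \<le> (d + \<delta>)\<^sup>2 * exp (4 * L * (b - a))"
  proof (rule mult_mono)
    have "p a \<le> d\<^sup>2"
      unfolding p_def power2_norm_eq_inner[symmetric] using d by (intro power_mono) auto
    moreover have "0 \<le> 2 * d * \<delta>"
      using d \<open>0 \<le> \<delta>\<close> norm_ge_zero[of "x a - z a"] by (intro mult_nonneg_nonneg) linarith+
    ultimately show "p a + \<delta>\<^sup>2 \<le> (d + \<delta>)\<^sup>2"
      unfolding power2_sum by linarith
    show "exp (3 * L * (t - a)) \<le> exp (4 * L * (b - a))"
      using t \<open>0 \<le> L\<close> by (auto intro!: mult_mono)
  qed auto
  also have "exp (4 * L * (b - a)) = (exp (2 * L * (b - a)))\<^sup>2"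
    by (simp add: exp_double[symmetric])
  finally have "p t + \<delta>\<^sup>2 \<le> ((d + \<delta>) * exp (2 * L * (b - a)))\<^sup>2"
    by (simp add: power_mult_distrib)
  moreover have "p t = (norm (x t - z t))\<^sup>2"
    by (simp add: p_def power2_norm_eq_inner)
  ultimately have "(norm (x t - z t))\<^sup>2 \<le> ((d + \<delta>) * exp (2 * L * (b - a)))\<^sup>2"
    using zero_le_power2[of \<delta>] by linarith
  moreover have "0 \<le> d" using d norm_ge_zero order_trans by blast
  ultimately show ?thesis
    using \<open>0 \<le> \<delta>\<close> power2_le_imp_le by (metis add_nonneg_nonneg exp_ge_zero mult_nonneg_nonneg)
qed

lemma first_exit_time:
  fixes x :: "real \<Rightarrow> 'a::real_normed_vector"
  assumes x: "continuous_on {a..b} x" and a: "norm (x a) < R"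
    and t: "t \<in> {a..b}" "R \<le> norm (x t)"
  obtains c where "c \<in> {a..b}" "norm (x c) = R" "\<forall>s\<in>{a..c}. norm (x s) \<le> R"
proof -
  define A where "A = {s \<in> {a..b}. norm (x s) = R}"
  have nx: "continuous_on {a..b} (\<lambda>s. norm (x s))" by (intro continuous_intros x)
  have ivt: "\<exists>s\<in>{a..s'}. norm (x s) = R" if "s' \<in> {a..b}" "R \<le> norm (x s')" for s'
    using IVT'[of "\<lambda>s. norm (x s)" a R s'] a that continuous_on_subset[OF nx, of "{a..s'}"] by force
  have "A = {a..b} \<inter> (\<lambda>s. norm (x s)) -` {R}" by (auto simp: A_def)
  then have "closed A"
    using nx by (simp add: continuous_closed_preimage)
  then have "compact A"
    using compact_Int_closed[of "{a..b}" A] by (simp add: A_def Int_absorb1 subset_iff)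
  moreover have "A \<noteq> {}"
  proof -
    from ivt[OF t] obtain s where "s \<in> {a..t}" "norm (x s) = R" by blast
    then have "s \<in> A" using t(1) by (simp add: A_def)
    then show ?thesis by blast
  qed
  ultimately obtain c where c: "c \<in> A" "\<forall>s\<in>A. c \<le> s"
    using compact_attains_inf by blast
  have "norm (x s) \<le> R" if "s \<in> {a..c}" for s
  proof (rule ccontr)
    assume *: "\<not> norm (x s) \<le> R"
    have s: "s \<in> {a..b}" using that c(1) by (simp add: A_def)
    with * obtain s' where s': "s' \<in> {a..s}" "norm (x s') = R"
      using ivt[of s] by auto
    then have "s' \<in> A" using s by (simp add: A_def)
    with c(2) have "c \<le> s'" by blast
    with s' have "s = s'" using that by simp
    then show False using * s'(2) by simp
  qed
  then show thesis using c(1) by (intro that[of c]) (auto simp: A_def)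
qed

text \<open>
  A bootstrap argument for a vector field that is Lipschitz only on a ball. The deviation of the inputs
  may itself rely on \<open>x\<close> having stayed in the ball (as it does under feedback); at the first
  exit time the estimate would hold up to that time and place \<open>x\<close> strictly inside, a contradiction.
\<close>

proposition trajectory_comparison:
  fixes F :: "'a::real_inner \<Rightarrow> real \<Rightarrow> 'a"
  assumes x: "plant_traj F {a..b} x u" and z: "plant_traj F {a..b} z v"
    and Lip: "\<forall>p q s t. norm p \<le> R \<and> norm q \<le> R \<and> s \<in> U \<and> t \<in> U \<longrightarrow>
       norm (F p s - F q t) \<le> L * (norm (p - q) + \<bar>s - t\<bar>)"
    and U: "\<And>t. t \<in> {a..b} \<Longrightarrow> u t \<in> U" "\<And>t. t \<in> {a..b} \<Longrightarrow> v t \<in> U"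
    and zR: "\<And>t. t \<in> {a..b} \<Longrightarrow> norm (z t) \<le> R - 1"
    and dev: "\<And>c. c \<in> {a..b} \<Longrightarrow> \<forall>t\<in>{a..c}. norm (x t) \<le> R \<Longrightarrow> \<bar>u c - v c\<bar> \<le> \<delta>"
    and d: "norm (x a - z a) \<le> d" and "0 \<le> L" "0 \<le> \<delta>"
    and small: "(d + \<delta>) * exp (2 * L * (b - a)) < 1" and t: "t \<in> {a..b}"
  shows "norm (x t) \<le> R" and "norm (x t - z t) \<le> (d + \<delta>) * exp (2 * L * (b - a))"
proof -
  have "a \<le> b" using t by simp
  have "0 \<le> d" using d norm_ge_zero order_trans by blast
  have close: "norm (x c - z c) \<le> (d + \<delta>) * exp (2 * L * (b - a))"
    if c: "c \<in> {a..b}" and xR: "\<forall>t\<in>{a..c}. norm (x t) \<le> R" for c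
  proof -
    have "norm (x c - z c) \<le> (d + \<delta>) * exp (2 * L * (c - a))"
    proof (rule trajectory_distance_bound[where u = u and v = v])
      show "plant_traj F {a..c} x u" "plant_traj F {a..c} z v"
        using x z c by (auto elim!: plant_traj_subset)
      fix s assume s: "s \<in> {a..c}"
      have "norm (F (x s) (u s) - F (z s) (v s)) \<le> L * (norm (x s - z s) + \<bar>u s - v s\<bar>)"
        using s c xR zR[of s] U[of s] by (intro Lip[rule_format]) auto
      also have "\<dots> \<le> L * (norm (x s - z s) + \<delta>)"
        using dev[of s] s c xR \<open>0 \<le> L\<close> by (intro mult_left_mono add_left_mono) auto
      finally show "norm (F (x s) (u s) - F (z s) (v s)) \<le> L * (norm (x s - z s) + \<delta>)" .
    qed (use c d \<open>0 \<le> L\<close> \<open>0 \<le> \<delta>\<close> in auto)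
    also have "\<dots> \<le> (d + \<delta>) * exp (2 * L * (b - a))"
      using c \<open>0 \<le> L\<close> \<open>0 \<le> \<delta>\<close> \<open>0 \<le> d\<close> by (intro mult_left_mono) (auto intro!: mult_left_mono)
    finally show ?thesis .
  qed
  have inside: "norm (x c) < R" if "c \<in> {a..b}" "norm (x c - z c) \<le> (d + \<delta>) * exp (2 * L * (b - a))" for c
    using norm_triangle_ineq[of "x c - z c" "z c"] zR[OF that(1)] that(2) small by simp
  have "(d + \<delta>) * 1 \<le> (d + \<delta>) * exp (2 * L * (b - a))"
    using \<open>0 \<le> L\<close> \<open>0 \<le> \<delta>\<close> \<open>0 \<le> d\<close> \<open>a \<le> b\<close> by (intro mult_left_mono) auto
  then have xa: "norm (x a) < R"
    using d \<open>0 \<le> \<delta>\<close> \<open>a \<le> b\<close> by (intro inside) auto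
  have all: "norm (x s) \<le> R" if "s \<in> {a..b}" for s
  proof (rule ccontr)
    assume "\<not> norm (x s) \<le> R"
    then have "R \<le> norm (x s)" by simp
    with plant_traj_continuous_on[OF x] xa that
    obtain c where "c \<in> {a..b}" "norm (x c) = R" "\<forall>s\<in>{a..c}. norm (x s) \<le> R"
      by (rule first_exit_time)
    then show False using inside[OF _ close, of c] by auto
  qed
  show "norm (x t) \<le> R" by (rule all[OF t])
  show "norm (x t - z t) \<le> (d + \<delta>) * exp (2 * L * (b - a))"
    by (rule close[OF t]) (use all t in auto)
qed

section \<open>Trajectories ending in a compact set\<close>

text \<open>
  Reversed in time, the trajectories start in \<open>K\<close>. One backward trajectory from a point of \<open>K\<close> bounds, by
  comparison, all trajectories that start near that point with a nearby input; finitely many such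
  neighbourhoods cover \<open>K\<close>.
\<close>

proposition trajectories_into_compact_set_bounded:
  fixes f :: "'a::euclidean_space \<Rightarrow> real \<Rightarrow> 'a"
  assumes f: "C1_map (\<lambda>(x, u). f x u)" and "0 \<le> T"
    and K: "compact K" "K \<subseteq> UNIV \<times> {umin..umax}"
    and backward: "\<And>y u0. (y, u0) \<in> K \<Longrightarrow> \<exists>x. plant_traj f {..0} x (\<lambda>_. u0) \<and> x 0 = y"
  obtains R where "\<forall>z u0. plant_traj f {0..T} z (\<lambda>_. u0) \<and> (z T, u0) \<in> K \<longrightarrow> (\<forall>t\<in>{0..T}. norm (z t) \<le> R)"
proof -
  have "\<exists>\<eta>>0. \<exists>R. \<forall>z u0. plant_traj f {0..T} z (\<lambda>_. u0) \<and> (z T, u0) \<in> K \<inter> ball q \<eta> \<longrightarrow> (\<forall>t\<in>{0..T}. norm (z t) \<le> R)"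
    if q: "q \<in> K" for q
  proof -
    obtain y u1 where qe: "q = (y, u1)" by (cases q)
    with q K(2) have u1: "u1 \<in> {umin..umax}" by auto
    obtain \<zeta> where \<zeta>: "plant_traj f {..0} \<zeta> (\<lambda>_. u1)" "\<zeta> 0 = y"
      using backward q qe by blast
    define \<zeta>' where "\<zeta>' = (\<lambda>s. \<zeta> (-1 * s + 0))"
    have \<zeta>': "plant_traj (\<lambda>y w. - 1 *\<^sub>R f y w) {0..T} \<zeta>' (\<lambda>_. u1)"
      unfolding \<zeta>'_def by (rule plant_traj_affine[OF \<zeta>(1)]) simp
    have "bounded (\<zeta>' ` {0..T})"
      by (intro compact_imp_bounded compact_continuous_image plant_traj_continuous_on[OF \<zeta>']) simp
    then obtain R0 where R0: "\<forall>p\<in>\<zeta>' ` {0..T}. norm p \<le> R0"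
      unfolding bounded_iff by (elim exE) (rule that)
    define R where "R = R0 + 1"
    obtain L where L: "L > 0"
      "\<forall>p q s t. norm p \<le> R \<and> norm q \<le> R \<and> s \<in> {umin..umax} \<and> t \<in> {umin..umax} \<longrightarrow>
         norm (f p s - f q t) \<le> L * (norm (p - q) + \<bar>s - t\<bar>)"
      by (rule vector_field_Lipschitz[OF f])
    have Lneg: "\<forall>p q s t. norm p \<le> R \<and> norm q \<le> R \<and> s \<in> {umin..umax} \<and> t \<in> {umin..umax} \<longrightarrow>
         norm (- 1 *\<^sub>R f p s - (- 1 *\<^sub>R f q t)) \<le> L * (norm (p - q) + \<bar>s - t\<bar>)"
      using L(2) by (simp add: norm_minus_commute)
    \<comment> \<open>Chosen so that \<open>(\<eta> + \<eta>) * exp (2 * L * T) = 1 / 2\<close>, which is less than the margin 1 between \<open>R0\<close> and \<open>R\<close>.\<close>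
    define \<eta> where "\<eta> = exp (- (2 * L * T)) / 4"
    have "norm (z t) \<le> R"
      if z: "plant_traj f {0..T} z (\<lambda>_. u0)" and zK: "(z T, u0) \<in> K \<inter> ball q \<eta>" and t: "t \<in> {0..T}" for z u0 t
    proof -
      have u0: "u0 \<in> {umin..umax}" using zK K(2) by auto
      have dz: "norm (z T - y) \<le> \<eta>" and du: "\<bar>u0 - u1\<bar> \<le> \<eta>"
      proof -
        have "dist (z T, u0) q < \<eta>" using zK by (simp add: dist_commute)
        then show "norm (z T - y) \<le> \<eta>" "\<bar>u0 - u1\<bar> \<le> \<eta>"
          using dist_fst_le[of "(z T, u0)" q] dist_snd_le[of "(z T, u0)" q]
          by (auto simp: qe dist_norm[of "z T"] dist_real_def)
      qed
      have z': "plant_traj (\<lambda>y w. - 1 *\<^sub>R f y w) {0..T} (\<lambda>s. z (- 1 * s + T)) (\<lambda>_. u0)"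
        by (rule plant_traj_affine[OF z]) auto
      have "norm (z (- 1 * (T - t) + T)) \<le> R"
      proof (rule trajectory_comparison(1)[OF z' \<zeta>' Lneg])
        show "norm (z (- 1 * 0 + T) - \<zeta>' 0) \<le> \<eta>" using dz by (simp add: \<zeta>'_def \<zeta>(2))
        show "(\<eta> + \<eta>) * exp (2 * L * (T - 0)) < 1" by (simp add: \<eta>_def exp_minus)
        show "norm (\<zeta>' s) \<le> R - 1" if "s \<in> {0..T}" for s using R0 that by (simp add: R_def)
        show "0 \<le> \<eta>" by (simp add: \<eta>_def)
      qed (use u0 u1 du L(1) t in auto)
      then show ?thesis by simp
    qed
    moreover have "\<eta> > 0" by (simp add: \<eta>_def)
    ultimately show ?thesis by blast
  qed
  then obtain \<eta> R where \<eta>: "\<forall>q\<in>K. \<eta> q > 0"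
    and R: "\<forall>q\<in>K. \<forall>z u0. plant_traj f {0..T} z (\<lambda>_. u0) \<and> (z T, u0) \<in> K \<inter> ball q (\<eta> q) \<longrightarrow> (\<forall>t\<in>{0..T}. norm (z t) \<le> R q)"
    by metis
  have cover: "K \<subseteq> (\<Union>q\<in>K. ball q (\<eta> q))" using \<eta> by force
  from K(1) open_ball cover obtain C where C: "C \<subseteq> K" "finite C" "K \<subseteq> (\<Union>q\<in>C. ball q (\<eta> q))"
    by (rule compactE_image)
  have "norm (z t) \<le> Max (R ` C)"
    if z: "plant_traj f {0..T} z (\<lambda>_. u0)" and zK: "(z T, u0) \<in> K" and t: "t \<in> {0..T}" for z u0 t
  proof -
    obtain q where q: "q \<in> C" "(z T, u0) \<in> ball q (\<eta> q)" using C(3) zK by blast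
    then have "norm (z t) \<le> R q" using R C(1) z zK t by blast
    also have "R q \<le> Max (R ` C)" using q(1) C(2) by simp
    finally show ?thesis .
  qed
  then show thesis by (intro that) blast
qed

section \<open>Estimates in a ball around the equilibria\<close>

lemma eventually_at_right_times_less:
  fixes c d :: real
  assumes "d > 0"
  shows "\<forall>\<^sub>F k in at_right 0. k * c < d"
proof (rule order_tendstoD(2)[OF _ assms])
  show "((\<lambda>k. k * c) \<longlongrightarrow> 0) (at_right 0)" by (auto intro!: tendsto_eq_intros)
qed

text \<open>
  All estimates near the equilibria take place in one ball of radius \<open>R\<close>. It contains, with a margin of 1,
  every frozen trajectory starting within \<open>\<epsilon>0\<close> of its equilibrium, and \<open>f\<close> and \<open>g\<close> are Lipschitz on it.
  The window length \<open>\<tau>\<close> makes the frozen error contract by a factor 4, which beats the factor 2 lost when the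
  perturbed error is squared.
\<close>

locale tube =
  fixes f :: "'a::euclidean_space \<Rightarrow> real \<Rightarrow> 'a" and g :: "'a \<Rightarrow> real" and \<Xi> :: "real \<Rightarrow> 'a"
    and umin umax \<alpha> \<epsilon>0 lam m \<mu> r ur R L Lg \<tau> :: real
  assumes A2: "assumption2 f g umin umax \<alpha> \<Xi> \<epsilon>0 lam m \<mu>"
    and g_cont: "continuous_on UNIV g"
    and ur: "ur \<in> {umin..umax}" "g (\<Xi> ur) = r"
    and R: "\<And>w. w \<in> {umin..umax} \<Longrightarrow> norm (\<Xi> w) + m * \<epsilon>0 + 1 \<le> R"
    and L_pos: "L > 0"
    and L: "\<forall>p q s t. norm p \<le> R \<and> norm q \<le> R \<and> s \<in> {umin..umax} \<and> t \<in> {umin..umax} \<longrightarrow>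
         norm (f p s - f q t) \<le> L * (norm (p - q) + \<bar>s - t\<bar>)"
    and Lg_pos: "Lg > 0"
    and Lg: "\<And>p q. norm p \<le> R \<Longrightarrow> norm q \<le> R \<Longrightarrow> \<bar>g p - g q\<bar> \<le> Lg * norm (p - q)"
    and \<tau>: "\<tau> > 0" "m * exp (- lam * \<tau>) \<le> 1 / 4"
begin

lemma pos: "umin < umax" "\<alpha> > 0" "\<epsilon>0 > 0" "lam > 0" "m \<ge> 1" "\<mu> > 0"
  using A2 by (auto simp: assumption2_def assumption1_def)

lemma \<Xi>_Lipschitz: "s \<in> {umin..umax} \<Longrightarrow> t \<in> {umin..umax} \<Longrightarrow> norm (\<Xi> s - \<Xi> t) \<le> \<alpha> * \<bar>s - t\<bar>"
  using A2 lipschitz_onD[of \<alpha> "{umin..umax}" \<Xi> s t]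
  by (simp add: assumption2_def assumption1_def dist_norm)

lemma \<Xi>_cont: "continuous_on {umin..umax} \<Xi>"
  using A2 lipschitz_on_continuous_on by (auto simp: assumption2_def assumption1_def)

lemma \<Xi>_in_ball: "w \<in> {umin..umax} \<Longrightarrow> norm (\<Xi> w) \<le> R"
  using R[of w] mult_nonneg_nonneg[of m \<epsilon>0] pos by linarith

lemma R_pos: "R > 0"
  using R[OF ur(1)] mult_nonneg_nonneg[of m \<epsilon>0] pos norm_ge_zero[of "\<Xi> ur"] by linarith

lemma frozen_trajectory:
  assumes "u0 \<in> {umin..umax}" "norm (x0 - \<Xi> u0) \<le> \<epsilon>0"
  obtains z where "plant_traj f {a..} z (\<lambda>_. u0)" "z a = x0"
    "\<forall>t\<ge>a. norm (z t - \<Xi> u0) \<le> m * exp (- lam * (t - a)) * norm (x0 - \<Xi> u0)"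
proof -
  have "(\<exists>x. plant_traj f {0..} x (\<lambda>_. u0) \<and> x 0 = x0) \<and>
        (\<forall>x. plant_traj f {0..} x (\<lambda>_. u0) \<and> x 0 = x0 \<longrightarrow>
           (\<forall>t\<ge>0. norm (x t - \<Xi> u0) \<le> m * exp (- lam * t) * norm (x 0 - \<Xi> u0)))"
    using A2 assms unfolding assumption2_def assumption1_def by blast
  then obtain z where z: "plant_traj f {0..} z (\<lambda>_. u0)" "z 0 = x0"
    "\<forall>t\<ge>0. norm (z t - \<Xi> u0) \<le> m * exp (- lam * t) * norm (x0 - \<Xi> u0)"
    by blast
  have "plant_traj (\<lambda>y w. 1 *\<^sub>R f y w) {a..} (\<lambda>t. z (1 * t + - a)) (\<lambda>_. u0)"
    by (rule plant_traj_affine[OF z(1)]) simp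
  then have "plant_traj f {a..} (\<lambda>t. z (t - a)) (\<lambda>_. u0)" by simp
  then show thesis
    by (rule that) (use z(2,3) in auto)
qed

text \<open>
  \<open>M\<close> bounds the output error on the ball, and \<open>D\<close> bounds it relative to \<open>norm (x - \<Xi> u) + \<bar>u - ur\<bar>\<close>. If the
  latter quantity is at most \<open>Q\<close> on a window, then \<open>k * P * Q\<close> bounds the effect of feedback on that window,
  and \<open>A\<close> expresses this relative to the values at the start of the window. \<open>H1\<close> and \<open>H2\<close> collect
  the coefficients of \<open>k * e\<^sup>2\<close> and \<open>k\<^sup>2 * W\<close> in the estimate for \<open>W\<close> over one window.
\<close>

definition M :: real where "M = 2 * Lg * R"
definition D :: real where "D = Lg * (1 + \<alpha>)"
definition P :: real where "P = \<tau> * D * (exp (2 * L * \<tau>) + \<alpha> + 1)"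
definition A :: real where "A = 2 * m * P"
definition H1 :: real where "H1 = \<tau> * (2 * m\<^sup>2 * (Lg\<^sup>2 / \<mu>))"
definition H2 :: real where "H2 = (\<tau> * (3 * \<mu> + 2 * (Lg\<^sup>2 / \<mu>)) + 2) * (2 * A\<^sup>2)"

text \<open>
  In this order, beyond \<open>0 < k \<le> 1\<close>: trajectories stay in the ball for one window; the tube \<open>e \<le> \<epsilon>0\<close> is
  recovered at its end; the feedback loop within one window can be solved for \<open>e + v\<close>; the
  terms in \<open>k * e\<^sup>2\<close> are absorbed by the contraction of \<open>e\<^sup>2\<close>; and the terms of second order in \<open>k\<close> take at
  most a third of the decay of \<open>v\<^sup>2\<close>.
\<close>

definition small_gain :: "real \<Rightarrow> bool" where
  "small_gain k \<longleftrightarrow> 0 < k \<and> k \<le> 1 \<and>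
     k * (M * \<tau> * exp (2 * L * \<tau>)) < 1 \<and>
     k * (M * \<tau> * (exp (2 * L * \<tau>) + \<alpha>)) < 3 / 4 * \<epsilon>0 \<and>
     k * (4 * P) < 1 \<and>
     k * (H1 + 3 / 2 * \<mu> * \<tau>) < 7 / 8 \<and>
     k * H2 < \<mu> * \<tau> / 2"

lemma eventually_small_gain: "\<forall>\<^sub>F k in at_right 0. small_gain k"
proof -
  have 1: "\<forall>\<^sub>F k :: real in at_right 0. k \<le> 1"
    using eventually_at_right_times_less[of 1 1] by (rule eventually_mono) auto
  show ?thesis
    unfolding small_gain_def using pos \<tau>
    by (intro eventually_conj eventually_at_right_times_less 1 eventually_at_right_less) auto
qed

lemma output_error_bound:
  assumes "norm p \<le> R" shows "\<bar>r - g p\<bar> \<le> M"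
proof -
  have "\<bar>g (\<Xi> ur) - g p\<bar> \<le> Lg * norm (\<Xi> ur - p)"
    by (rule Lg[OF \<Xi>_in_ball[OF ur(1)] assms])
  also have "norm (\<Xi> ur - p) \<le> 2 * R"
    using norm_triangle_ineq4[of "\<Xi> ur" p] \<Xi>_in_ball[OF ur(1)] assms by linarith
  finally show ?thesis using Lg_pos ur(2) by (simp add: M_def)
qed

lemma state_error_le:
  assumes "w \<in> {umin..umax}"
  shows "norm (p - \<Xi> ur) \<le> norm (p - \<Xi> w) + \<alpha> * \<bar>w - ur\<bar>"
  using norm_triangle_ineq[of "p - \<Xi> w" "\<Xi> w - \<Xi> ur"] \<Xi>_Lipschitz[OF assms ur(1)] by simp

lemma output_error_le:
  assumes "norm p \<le> R" "w \<in> {umin..umax}"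
  shows "\<bar>r - g p\<bar> \<le> D * (norm (p - \<Xi> w) + \<bar>w - ur\<bar>)"
proof -
  have "\<bar>g (\<Xi> ur) - g p\<bar> \<le> Lg * norm (\<Xi> ur - p)"
    by (rule Lg[OF \<Xi>_in_ball[OF ur(1)] assms(1)])
  also have "\<dots> \<le> Lg * ((1 + \<alpha>) * (norm (p - \<Xi> w) + \<bar>w - ur\<bar>))"
  proof (rule mult_left_mono)
    have "0 \<le> \<alpha> * norm (p - \<Xi> w)" using pos by simp
    then have "norm (p - \<Xi> w) + \<alpha> * \<bar>w - ur\<bar> \<le> (1 + \<alpha>) * (norm (p - \<Xi> w) + \<bar>w - ur\<bar>)"
      by (simp add: algebra_simps)
    then show "norm (\<Xi> ur - p) \<le> (1 + \<alpha>) * (norm (p - \<Xi> w) + \<bar>w - ur\<bar>)"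
      using state_error_le[OF assms(2), of p] by (simp add: norm_minus_commute)
  qed (use Lg_pos in simp)
  finally show ?thesis by (simp add: ur(2) D_def mult.assoc)
qed

end

section \<open>The closed loop with small gain\<close>

locale closed_loop = tube f g \<Xi> umin umax \<alpha> \<epsilon>0 lam m \<mu> r ur R L Lg \<tau>
  for f :: "'a::euclidean_space \<Rightarrow> real \<Rightarrow> 'a" and g \<Xi> umin umax \<alpha> \<epsilon>0 lam m \<mu> r ur R L Lg \<tau> +
  fixes k :: real and x :: "real \<Rightarrow> 'a" and u :: "real \<Rightarrow> real"
  assumes loop: "closed_loop_traj f g umin umax k r x u" and k_pos: "k > 0"
begin

lemma x_traj: "plant_traj f {0..} x u" and u_traj: "sat_traj umin umax (\<lambda>t. k * (r - g (x t))) u"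
  using loop by (auto simp: closed_loop_traj_def)

lemma x_cont: "continuous_on {0..} x"
  by (rule plant_traj_continuous_on[OF x_traj])

lemma gx_cont: "continuous_on {0..} (\<lambda>t. g (x t))"
  by (rule continuous_on_compose2[OF g_cont x_cont]) simp

lemma w_cont: "continuous_on {0..} (\<lambda>t. k * (r - g (x t)))"
  by (intro continuous_intros gx_cont)

lemma u_range: "0 \<le> t \<Longrightarrow> u t \<in> {umin..umax}"
  by (rule sat_traj_range[OF u_traj w_cont])

lemma u_cont: "0 \<le> a \<Longrightarrow> continuous_on {a..b} u"
  by (rule sat_traj_continuous_on[OF u_traj w_cont])

lemma u_deviation:
  assumes "0 \<le> a" "t \<in> {a..b}" and B: "\<And>s. s \<in> {a..t} \<Longrightarrow> \<bar>r - g (x s)\<bar> \<le> B"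
  shows "\<bar>u t - u a\<bar> \<le> k * B * (b - a)"
proof -
  have "\<bar>r - g (x a)\<bar> \<le> B" using assms by auto
  then have "0 \<le> B" by linarith
  have "\<bar>u t - u a\<bar> \<le> k * B * (t - a)"
    by (rule sat_traj_Lipschitz[OF u_traj w_cont])
      (use assms k_pos in \<open>auto simp: abs_mult\<close>)
  also have "\<dots> \<le> k * B * (b - a)"
    using assms(2) k_pos \<open>0 \<le> B\<close> by (intro mult_left_mono) auto
  finally show ?thesis .
qed

text \<open>
  Membership in the ball comes first, with the crude bound \<open>M\<close> on the output error. Once it is known,
  the distance to \<open>z\<close> is estimated by an arbitrary bound \<open>B\<close> of the output error, in particular by one
  that is proportional to \<open>e + v\<close> and makes the estimate linear in the error.
\<close>

lemma frozen_input_comparison: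
  assumes ab: "0 \<le> a" and z: "plant_traj f {a..b} z (\<lambda>_. u a)" "z a = x a"
    and zR: "\<And>t. t \<in> {a..b} \<Longrightarrow> norm (z t) \<le> R - 1"
    and small: "k * (M * (b - a) * exp (2 * L * (b - a))) < 1" and t: "t \<in> {a..b}"
  shows "norm (x t) \<le> R"
    and "(\<And>s. s \<in> {a..b} \<Longrightarrow> \<bar>r - g (x s)\<bar> \<le> B) \<Longrightarrow>
           norm (x t - z t) \<le> k * B * (b - a) * exp (2 * L * (b - a))"
proof -
  have x: "plant_traj f {a..b} x u"
    using ab by (intro plant_traj_subset[OF x_traj]) auto
  have range: "u s \<in> {umin..umax}" if "s \<in> {a..b}" for s
    using u_range that ab by auto
  have ua: "u a \<in> {umin..umax}" using u_range ab by simp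
  have M: "0 \<le> M" unfolding M_def using Lg_pos R_pos by simp
  have xR: "norm (x t) \<le> R" if t: "t \<in> {a..b}" for t
  proof (rule trajectory_comparison(1)[OF x z(1) L])
    show "\<bar>u c - u a\<bar> \<le> k * M * (b - a)" if "c \<in> {a..b}" "\<forall>t\<in>{a..c}. norm (x t) \<le> R" for c
      using that by (intro u_deviation[OF ab] output_error_bound) auto
    show "(0 + k * M * (b - a)) * exp (2 * L * (b - a)) < 1"
      using small by (simp add: mult.assoc)
    show "0 \<le> k * M * (b - a)" using k_pos M t by simp
  qed (use z range ua zR L_pos t in auto)
  then show "norm (x t) \<le> R" using t .
  show "norm (x t - z t) \<le> k * B * (b - a) * exp (2 * L * (b - a))"
    if B: "\<And>s. s \<in> {a..b} \<Longrightarrow> \<bar>r - g (x s)\<bar> \<le> B"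
  proof -
    have "\<bar>r - g (x t)\<bar> \<le> B" using B t .
    then have "0 \<le> B" by linarith
    have "norm (x t - z t) \<le> (0 + k * B * (b - a)) * exp (2 * L * (b - a))"
    proof (rule trajectory_distance_bound[OF x z(1)])
      fix s assume s: "s \<in> {a..b}"
      have "norm (f (x s) (u s) - f (z s) (u a)) \<le> L * (norm (x s - z s) + \<bar>u s - u a\<bar>)"
        using s xR zR[of s] range ua by (intro L[rule_format]) auto
      also have "\<dots> \<le> L * (norm (x s - z s) + k * B * (b - a))"
        using L_pos s by (intro mult_left_mono add_left_mono u_deviation[OF ab] B) auto
      finally show "norm (f (x s) (u s) - f (z s) (u a)) \<le> L * (norm (x s - z s) + k * B * (b - a))" .
    qed (use z L_pos k_pos \<open>0 \<le> B\<close> t in auto)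
    then show ?thesis by simp
  qed
qed

definition e :: "real \<Rightarrow> real" where "e t = norm (x t - \<Xi> (u t))"
definition v :: "real \<Rightarrow> real" where "v t = \<bar>u t - ur\<bar>"

lemma e_v_nonneg: "0 \<le> e t" "0 \<le> v t"
  by (auto simp: e_def v_def)

lemma e_v_cont:
  assumes "0 \<le> a"
  shows "continuous_on {a..b} (\<lambda>t. e t + v t)"
proof -
  have "continuous_on {a..b} (\<lambda>t. \<Xi> (u t))"
    by (rule continuous_on_compose2[OF \<Xi>_cont u_cont[OF assms]]) (use u_range assms in auto)
  moreover have "continuous_on {a..b} x"
    by (rule continuous_on_subset[OF x_cont]) (use assms in auto)
  ultimately show ?thesis
    unfolding e_def v_def by (intro continuous_intros u_cont[OF assms])
qed

text \<open>
  Triangle inequality through the frozen trajectory \<open>z\<close> and its equilibrium: the three distances are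
  \<open>x t\<close> to \<open>z t\<close>, then to \<open>\<Xi> (u a)\<close>, then to \<open>\<Xi> (u t)\<close>.
\<close>

lemma window:
  assumes a: "0 \<le> a" and ea: "e a \<le> \<epsilon>0" and small: "k * (M * \<tau> * exp (2 * L * \<tau>)) < 1"
    and t: "t \<in> {a..a + \<tau>}"
  shows "norm (x t) \<le> R"
    and "(\<And>s. s \<in> {a..a + \<tau>} \<Longrightarrow> \<bar>r - g (x s)\<bar> \<le> B) \<Longrightarrow>
      e t \<le> m * exp (- lam * (t - a)) * e a + k * B * \<tau> * (exp (2 * L * \<tau>) + \<alpha>)"
proof -
  have ua: "u a \<in> {umin..umax}" using u_range a by simp
  obtain z where z: "plant_traj f {a..} z (\<lambda>_. u a)" "z a = x a"
    "\<forall>t\<ge>a. norm (z t - \<Xi> (u a)) \<le> m * exp (- lam * (t - a)) * norm (x a - \<Xi> (u a))"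
    using ua ea unfolding e_def by (rule frozen_trajectory)
  have z': "plant_traj f {a..a + \<tau>} z (\<lambda>_. u a)"
    by (rule plant_traj_subset[OF z(1)]) auto
  have zR: "norm (z s) \<le> R - 1" if "s \<in> {a..a + \<tau>}" for s
  proof -
    have "m * exp (- lam * (s - a)) * norm (x a - \<Xi> (u a)) \<le> m * 1 * \<epsilon>0"
      using that pos ea by (intro mult_mono) (auto simp: e_def)
    then have "norm (z s - \<Xi> (u a)) \<le> m * \<epsilon>0" using z(3) that by fastforce
    then show ?thesis
      using norm_triangle_ineq[of "z s - \<Xi> (u a)" "\<Xi> (u a)"] R[OF ua] by simp
  qed
  have small': "k * (M * (a + \<tau> - a) * exp (2 * L * (a + \<tau> - a))) < 1" using small by simp
  show "norm (x t) \<le> R"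
    by (rule frozen_input_comparison(1)[OF a z' z(2) _ small' t]) (rule zR)
  show "e t \<le> m * exp (- lam * (t - a)) * e a + k * B * \<tau> * (exp (2 * L * \<tau>) + \<alpha>)"
    if B: "\<And>s. s \<in> {a..a + \<tau>} \<Longrightarrow> \<bar>r - g (x s)\<bar> \<le> B"
  proof -
    have 1: "norm (x t - z t) \<le> k * B * \<tau> * exp (2 * L * \<tau>)"
      using frozen_input_comparison(2)[OF a z' z(2) zR small' t B] by simp
    have "\<bar>u t - u a\<bar> \<le> k * B * \<tau>"
      using u_deviation[OF a t B] t by simp
    then have "\<alpha> * \<bar>u a - u t\<bar> \<le> \<alpha> * (k * B * \<tau>)"
      using pos by (intro mult_left_mono) auto
    with \<Xi>_Lipschitz[OF ua u_range[of t]] a t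
    have 2: "norm (\<Xi> (u a) - \<Xi> (u t)) \<le> \<alpha> * (k * B * \<tau>)" by simp
    have 3: "norm (z t - \<Xi> (u a)) \<le> m * exp (- lam * (t - a)) * e a"
      using z(3) t by (simp add: e_def)
    have "e t \<le> norm (x t - z t) + norm (z t - \<Xi> (u a)) + norm (\<Xi> (u a) - \<Xi> (u t))"
      unfolding e_def using norm_triangle_ineq[of "x t - z t" "z t - \<Xi> (u t)"]
        norm_triangle_ineq[of "z t - \<Xi> (u a)" "\<Xi> (u a) - \<Xi> (u t)"] by simp
    with 1 2 3 show ?thesis by (simp add: algebra_simps)
  qed
qed

lemma window_stays:
  assumes "0 \<le> a" "e a \<le> \<epsilon>0" "small_gain k"
  shows "e (a + \<tau>) \<le> \<epsilon>0"
proof -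
  have s: "k * (M * \<tau> * exp (2 * L * \<tau>)) < 1" "k * (M * \<tau> * (exp (2 * L * \<tau>) + \<alpha>)) < 3 / 4 * \<epsilon>0"
    using assms(3) by (auto simp: small_gain_def)
  have "e (a + \<tau>) \<le> m * exp (- lam * (a + \<tau> - a)) * e a + k * M * \<tau> * (exp (2 * L * \<tau>) + \<alpha>)"
    using \<tau> by (intro window(2)[OF assms(1,2) s(1)] output_error_bound window(1)[OF assms(1,2) s(1)]) auto
  also have "m * exp (- lam * (a + \<tau> - a)) * e a \<le> 1 / 4 * \<epsilon>0"
    using \<tau> assms(2) e_v_nonneg by (intro mult_mono) auto
  finally show ?thesis using s(2) unfolding mult.assoc by linarith
qed

text \<open>
  Let \<open>Q\<close> be the maximum of \<open>e + v\<close> on the window. The output error is at most \<open>D * Q\<close>, which bounds \<open>e + v\<close>,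
  and hence \<open>Q\<close> itself, by \<open>m * (e a + v a) + 2 * k * P * Q\<close>; for small \<open>k\<close> the last term is
  absorbed on the left.
\<close>

lemma window_linear_bounds:
  assumes a: "0 \<le> a" and ea: "e a \<le> \<epsilon>0" and small: "small_gain k"
    and t: "t \<in> {a..a + \<tau>}"
  shows "\<bar>u t - u a\<bar> \<le> k * A * (e a + v a)"
    and "e t \<le> m * exp (- lam * (t - a)) * e a + k * A * (e a + v a)"
    and "e t + v t \<le> 2 * m * (e a + v a)"
proof -
  have s: "k * (M * \<tau> * exp (2 * L * \<tau>)) < 1" "k * (4 * P) < 1"
    using small by (auto simp: small_gain_def)
  have "\<exists>q\<in>{a..a + \<tau>}. \<forall>s\<in>{a..a + \<tau>}. e s + v s \<le> e q + v q"
    using \<tau> by (intro continuous_attains_sup e_v_cont[OF a]) auto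
  then obtain q where q: "q \<in> {a..a + \<tau>}" "\<forall>s\<in>{a..a + \<tau>}. e s + v s \<le> e q + v q"
    by blast
  define Q where "Q = e q + v q"
  have Q0: "0 \<le> Q" using e_v_nonneg[of q] by (simp add: Q_def)
  have D0: "0 < D" and P0: "0 < P"
    using Lg_pos pos \<tau> by (auto simp: D_def P_def intro!: mult_pos_pos add_pos_pos)
  have B: "\<bar>r - g (x s)\<bar> \<le> D * Q" if "s \<in> {a..a + \<tau>}" for s
  proof -
    have "\<bar>r - g (x s)\<bar> \<le> D * (e s + v s)"
      using output_error_le[OF window(1)[OF a ea s(1) that] u_range[of s]] that a by (simp add: e_def v_def)
    also have "\<dots> \<le> D * Q" using q(2) that D0 by (intro mult_left_mono) (auto simp: Q_def)
    finally show ?thesis .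
  qed
  have kQ: "0 \<le> k * Q" using k_pos Q0 by simp
  have "0 \<le> k * Q * (\<tau> * D)" "0 \<le> k * Q * (\<tau> * D * \<alpha>)" "0 \<le> k * Q * (\<tau> * D * exp (2 * L * \<tau>))"
    using k_pos Q0 \<tau> D0 pos by auto
  then have PP: "k * (D * Q) * \<tau> \<le> k * P * Q" "k * (D * Q) * \<tau> * (exp (2 * L * \<tau>) + \<alpha>) \<le> k * P * Q"
    by (auto simp: P_def algebra_simps)
  have du: "\<bar>u s - u a\<bar> \<le> k * P * Q" if "s \<in> {a..a + \<tau>}" for s
    using u_deviation[OF a that B] that PP(1) by simp
  have de: "e s \<le> m * exp (- lam * (s - a)) * e a + k * P * Q" if "s \<in> {a..a + \<tau>}" for s
    using window(2)[OF a ea s(1) that B] PP(2) by simp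
  have dem: "m * exp (- lam * (s - a)) * e a \<le> m * e a" if "s \<in> {a..a + \<tau>}" for s
    using that pos e_v_nonneg by (intro mult_right_mono mult_left_le) auto
  have "v q \<le> v a + k * P * Q" using du[OF q(1)] by (simp add: v_def)
  moreover have "e q \<le> m * e a + k * P * Q" using de[OF q(1)] dem[OF q(1)] by simp
  moreover have "k * P * Q \<le> Q / 4"
    using mult_right_mono[OF less_imp_le[OF s(2)] Q0] by simp
  moreover have "v a \<le> m * v a"
    using pos e_v_nonneg mult_right_mono[of 1 m "v a"] by simp
  ultimately have Q: "Q \<le> 2 * m * (e a + v a)"
    unfolding Q_def[symmetric] using Q_def by (simp add: algebra_simps)
  then have PA: "k * P * Q \<le> k * A * (e a + v a)"
    using k_pos P0 mult_left_mono[OF Q, of "k * P"] by (simp add: A_def mult_ac)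
  show "\<bar>u t - u a\<bar> \<le> k * A * (e a + v a)" using du[OF t] PA by simp
  show "e t \<le> m * exp (- lam * (t - a)) * e a + k * A * (e a + v a)" using de[OF t] PA by simp
  show "e t + v t \<le> 2 * m * (e a + v a)" using q(2)[rule_format, OF t] Q
    unfolding Q_def by (rule order_trans)
qed

definition W :: "real \<Rightarrow> real" where "W t = (v t)\<^sup>2 + (e t)\<^sup>2"

lemma sum_square_le_W: "(e t + v t)\<^sup>2 \<le> 2 * W t"
proof -
  have "0 \<le> (e t - v t)\<^sup>2" by simp
  then show ?thesis unfolding W_def power2_sum power2_diff by simp
qed

text \<open>
  Write \<open>r - g x = (r - g (\<Xi> u)) + (g (\<Xi> u) - g x)\<close>. The first part yields \<open>- 4 * \<mu> * v\<^sup>2\<close> by the monotonicity of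
  \<open>g (\<Xi> u)\<close>; the second is at most \<open>Lg * e\<close>, and Young's inequality spends one quarter of the decay on it.
\<close>

lemma integrator_dissipation:
  assumes "0 \<le> t" "norm (x t) \<le> R"
  shows "2 * (u t - ur) * (k * (r - g (x t))) \<le> k * (- 3 * \<mu> * (v t)\<^sup>2 + Lg\<^sup>2 / \<mu> * (e t)\<^sup>2)"
proof -
  have ut: "u t \<in> {umin..umax}" by (rule u_range[OF assms(1)])
  have mono: "(u t - ur) * (g (\<Xi> (u t)) - r) \<ge> 2 * \<mu> * (v t)\<^sup>2"
  proof -
    have G: "g (\<Xi> s) - g (\<Xi> s') \<ge> 2 * \<mu> * (s - s')" if "s \<in> {umin..umax}" "s' \<in> {umin..umax}" "s > s'" for s s'
      using A2 that unfolding assumption2_def by blast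
    consider "u t > ur" | "u t < ur" | "u t = ur" by linarith
    then show ?thesis
    proof cases
      case 1
      then show ?thesis
        using mult_left_mono[OF G[OF ut ur(1)], of "u t - ur"]
        by (simp add: v_def ur(2) power2_eq_square mult_ac)
    next
      case 2
      then show ?thesis
        using mult_left_mono[OF G[OF ur(1) ut], of "ur - u t"]
        by (simp add: v_def ur(2) power2_eq_square algebra_simps)
    qed (simp add: v_def)
  qed
  have "\<bar>g (\<Xi> (u t)) - g (x t)\<bar> \<le> Lg * e t"
    using Lg[OF \<Xi>_in_ball[OF ut] assms(2)] by (simp add: e_def norm_minus_commute)
  then have "\<bar>(u t - ur) * (g (\<Xi> (u t)) - g (x t))\<bar> \<le> v t * (Lg * e t)"
    unfolding abs_mult v_def by (intro mult_left_mono) auto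
  moreover have "2 * (v t * (Lg * e t)) \<le> \<mu> * (v t)\<^sup>2 + Lg\<^sup>2 / \<mu> * (e t)\<^sup>2"
  proof -
    have "0 \<le> (\<mu> * v t - Lg * e t)\<^sup>2 / \<mu>" using pos by simp
    also have "\<dots> = \<mu> * (v t)\<^sup>2 + Lg\<^sup>2 / \<mu> * (e t)\<^sup>2 - 2 * (v t * (Lg * e t))"
      using pos by (simp add: power2_eq_square field_simps)
    finally show ?thesis by simp
  qed
  moreover have "(u t - ur) * (r - g (x t)) = - ((u t - ur) * (g (\<Xi> (u t)) - r)) + (u t - ur) * (g (\<Xi> (u t)) - g (x t))"
    by (simp add: algebra_simps)
  ultimately have *: "2 * ((u t - ur) * (r - g (x t))) \<le> - 3 * \<mu> * (v t)\<^sup>2 + Lg\<^sup>2 / \<mu> * (e t)\<^sup>2"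
    using mono by (simp add: abs_le_iff)
  have "2 * (u t - ur) * (k * (r - g (x t))) = k * (2 * ((u t - ur) * (r - g (x t))))"
    by (simp add: mult_ac)
  also have "\<dots> \<le> k * (- 3 * \<mu> * (v t)\<^sup>2 + Lg\<^sup>2 / \<mu> * (e t)\<^sup>2)"
    by (rule mult_left_mono[OF * less_imp_le[OF k_pos]])
  finally show ?thesis .
qed

text \<open>
  On the window, \<open>v\<^sup>2\<close> and \<open>e\<^sup>2\<close> are replaced by their initial values up to \<open>Z\<close>, which is of second order in
  \<open>k\<close>. Of the decay \<open>3/2 * k * \<mu> * \<tau> * v\<^sup>2\<close> that this leaves, one third pays for the \<open>Z\<close> terms.
\<close>

lemma W_decay:
  assumes a: "0 \<le> a" and ea: "e a \<le> \<epsilon>0" and small: "small_gain k"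
  shows "W (a + \<tau>) \<le> (1 - k * \<mu> * \<tau>) * W a"
proof -
  define Z where "Z = 2 * k\<^sup>2 * A\<^sup>2 * W a"
  define d where "d = k * A * (e a + v a)"
  have s: "k \<le> 1" "k * (M * \<tau> * exp (2 * L * \<tau>)) < 1" "k * (H1 + 3 / 2 * \<mu> * \<tau>) < 7 / 8" "k * H2 < \<mu> * \<tau> / 2"
    using small by (auto simp: small_gain_def)
  have W0: "0 \<le> W a" by (simp add: W_def)
  have Z0: "0 \<le> Z" using W0 by (simp add: Z_def)
  have dZ: "d\<^sup>2 \<le> Z"
    using mult_left_mono[OF sum_square_le_W, of "k\<^sup>2 * A\<^sup>2" a]
    by (simp add: d_def Z_def power_mult_distrib mult_ac)
  note bnd = window_linear_bounds[OF a ea small, folded d_def]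
  have young: "p\<^sup>2 \<le> 2 * q\<^sup>2 + 2 * d\<^sup>2" if "\<bar>p\<bar> \<le> \<bar>q\<bar> + d" for p q :: real
  proof -
    have "p\<^sup>2 \<le> (\<bar>q\<bar> + d)\<^sup>2" using that by (simp add: abs_le_square_iff[symmetric])
    moreover have "0 \<le> (\<bar>q\<bar> - d)\<^sup>2" by simp
    ultimately show ?thesis unfolding power2_sum power2_diff by simp
  qed
  have vt: "- 3 * \<mu> * (v t)\<^sup>2 \<le> - 3 * \<mu> * ((v a)\<^sup>2 / 2 - Z)" if "t \<in> {a..a + \<tau>}" for t
  proof -
    have "(v a)\<^sup>2 \<le> 2 * (v t)\<^sup>2 + 2 * d\<^sup>2"
      using bnd(1)[OF that] by (intro young) (simp add: v_def)
    with dZ pos show ?thesis by (simp add: mult_left_mono_neg)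
  qed
  have et: "Lg\<^sup>2 / \<mu> * (e t)\<^sup>2 \<le> Lg\<^sup>2 / \<mu> * (2 * m\<^sup>2 * (e a)\<^sup>2 + 2 * Z)" if "t \<in> {a..a + \<tau>}" for t
  proof -
    have "m * exp (- lam * (t - a)) * e a \<le> m * e a"
      using that pos e_v_nonneg by (intro mult_right_mono mult_left_le) auto
    then have "(e t)\<^sup>2 \<le> 2 * (m * e a)\<^sup>2 + 2 * d\<^sup>2"
      using bnd(2)[OF that] e_v_nonneg[of t] by (intro young) linarith
    with dZ have "(e t)\<^sup>2 \<le> 2 * m\<^sup>2 * (e a)\<^sup>2 + 2 * Z" by (simp add: power_mult_distrib)
    then show ?thesis using pos by (intro mult_left_mono) auto
  qed
  define \<beta> where "\<beta> = k * (- 3 * \<mu> * ((v a)\<^sup>2 / 2 - Z) + Lg\<^sup>2 / \<mu> * (2 * m\<^sup>2 * (e a)\<^sup>2 + 2 * Z))"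
  have "(u (a + \<tau>) - ur)\<^sup>2 \<le> (u a - ur)\<^sup>2 + \<beta> * (a + \<tau> - a)"
  proof (rule sat_traj_square_le[OF u_traj w_cont a _ ur(1)])
    fix t assume t: "t \<in> {a..a + \<tau>}"
    have "2 * (u t - ur) * (k * (r - g (x t))) \<le> k * (- 3 * \<mu> * (v t)\<^sup>2 + Lg\<^sup>2 / \<mu> * (e t)\<^sup>2)"
      using t a by (intro integrator_dissipation window(1)[OF a ea s(2)]) auto
    also have "\<dots> \<le> \<beta>"
      unfolding \<beta>_def by (rule mult_left_mono[OF add_mono[OF vt[OF t] et[OF t]] less_imp_le[OF k_pos]])
    finally show "2 * (u t - ur) * (k * (r - g (x t))) \<le> \<beta>" .
  qed (use \<tau> in simp)
  then have V: "(v (a + \<tau>))\<^sup>2 \<le> (v a)\<^sup>2 + \<beta> * \<tau>" by (simp add: v_def)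
  have "m * exp (- lam * (a + \<tau> - a)) * e a \<le> 1 / 4 * e a"
    using \<tau> e_v_nonneg by (intro mult_right_mono) auto
  then have "(e (a + \<tau>))\<^sup>2 \<le> 2 * (1 / 4 * e a)\<^sup>2 + 2 * d\<^sup>2"
    using bnd(2)[of "a + \<tau>"] \<tau> e_v_nonneg[of "a + \<tau>"] e_v_nonneg[of a] by (intro young) auto
  then have E: "(e (a + \<tau>))\<^sup>2 \<le> (e a)\<^sup>2 / 8 + 2 * Z"
    using dZ by (simp add: power_mult_distrib power2_eq_square)
  have "\<beta> * \<tau> = - (3 / 2) * (k * \<mu> * \<tau>) * (v a)\<^sup>2 + k * H1 * (e a)\<^sup>2 + k * (\<tau> * (3 * \<mu> + 2 * (Lg\<^sup>2 / \<mu>)) * Z)"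
    by (simp add: \<beta>_def H1_def algebra_simps)
  also have "k * (\<tau> * (3 * \<mu> + 2 * (Lg\<^sup>2 / \<mu>)) * Z) \<le> \<tau> * (3 * \<mu> + 2 * (Lg\<^sup>2 / \<mu>)) * Z"
    using s(1) k_pos Z0 \<tau> pos by (intro mult_left_le_one_le) auto
  finally have \<beta>: "\<beta> * \<tau> \<le> - (3 / 2) * (k * \<mu> * \<tau>) * (v a)\<^sup>2 + k * H1 * (e a)\<^sup>2 + \<tau> * (3 * \<mu> + 2 * (Lg\<^sup>2 / \<mu>)) * Z"
    by simp
  have "\<tau> * (3 * \<mu> + 2 * (Lg\<^sup>2 / \<mu>)) * Z + 2 * Z = k * (k * H2) * W a"
    by (simp add: Z_def H2_def power2_eq_square algebra_simps)
  also have "\<dots> \<le> k * (\<mu> * \<tau> / 2) * W a"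
    using s(4) k_pos W0 by (intro mult_right_mono mult_left_mono) auto
  finally have ZW: "\<tau> * (3 * \<mu> + 2 * (Lg\<^sup>2 / \<mu>)) * Z + 2 * Z \<le> k * \<mu> * \<tau> / 2 * ((v a)\<^sup>2 + (e a)\<^sup>2)"
    by (simp add: W_def mult.assoc)
  have "k * (H1 + 3 / 2 * \<mu> * \<tau>) * (e a)\<^sup>2 \<le> 7 / 8 * (e a)\<^sup>2"
    using s(3) by (intro mult_right_mono) auto
  with V E \<beta> ZW show ?thesis
    unfolding W_def by (simp add: algebra_simps)
qed

text \<open>
  Decay holds on the grid \<open>T + n * \<tau>\<close>, and each window is controlled by its left end point. The rate is halved
  because \<open>W\<close> is quadratic in \<open>e\<close> and \<open>v\<close>.
\<close>

proposition exponential_convergence: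
  assumes T: "0 \<le> T" and eT: "e T \<le> \<epsilon>0" and small: "small_gain k"
  obtains C where "0 < C" "\<forall>t\<ge>T. norm (x t) \<le> R \<and> e t + v t \<le> C * exp (- (k * \<mu> / 2) * t)"
proof -
  have grid: "e (T + real n * \<tau>) \<le> \<epsilon>0 \<and> W (T + real n * \<tau>) \<le> exp (- (k * \<mu> * \<tau> * real n)) * W T" for n
  proof (induction n)
    case 0
    show ?case using eT by simp
  next
    case (Suc n)
    define a where "a = T + real n * \<tau>"
    have a: "0 \<le> a" using T \<tau> by (simp add: a_def)
    have Sa: "T + real (Suc n) * \<tau> = a + \<tau>" by (simp add: a_def algebra_simps)
    have ea: "e a \<le> \<epsilon>0" and Wa: "W a \<le> exp (- (k * \<mu> * \<tau> * real n)) * W T"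
      using Suc.IH by (auto simp: a_def)
    have "W (a + \<tau>) \<le> (1 - k * \<mu> * \<tau>) * W a" by (rule W_decay[OF a ea small])
    also have "\<dots> \<le> exp (- (k * \<mu> * \<tau>)) * W a"
      using exp_ge_add_one_self[of "- (k * \<mu> * \<tau>)"] by (intro mult_right_mono) (auto simp: W_def)
    also have "\<dots> \<le> exp (- (k * \<mu> * \<tau>)) * (exp (- (k * \<mu> * \<tau> * real n)) * W T)"
      by (intro mult_left_mono Wa) simp
    also have "\<dots> = exp (- (k * \<mu> * \<tau>) + - (k * \<mu> * \<tau> * real n)) * W T"
      by (simp only: exp_add mult.assoc)
    also have "- (k * \<mu> * \<tau>) + - (k * \<mu> * \<tau> * real n) = - (k * \<mu> * \<tau> * real (Suc n))"
      by (simp add: algebra_simps)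
    finally show ?case
      using window_stays[OF a ea small] by (simp only: Sa)
  qed
  define c where "c = 2 * m * sqrt (2 * W T) * exp (k * \<mu> / 2 * (T + \<tau>))"
  have c0: "0 \<le> c" using pos by (simp add: c_def W_def)
  have bound: "norm (x t) \<le> R \<and> e t + v t \<le> (c + 1) * exp (- (k * \<mu> / 2) * t)" if t: "t \<ge> T" for t
  proof -
    define n where "n = nat \<lfloor>(t - T) / \<tau>\<rfloor>"
    have "real n \<le> (t - T) / \<tau>" "(t - T) / \<tau> < real n + 1"
      using t \<tau> unfolding n_def by (auto simp: le_floor_iff)
    then have n: "T + real n * \<tau> \<le> t" "t < T + real n * \<tau> + \<tau>"
      using \<tau> by (simp_all add: field_simps)
    define a where "a = T + real n * \<tau>"
    have a: "0 \<le> a" using T \<tau> by (simp add: a_def)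
    have ea: "e a \<le> \<epsilon>0" and Wa: "W a \<le> exp (- (k * \<mu> * \<tau> * real n)) * W T"
      using grid by (auto simp: a_def)
    have "e a + v a \<le> sqrt (2 * W a)"
      by (rule real_le_rsqrt[OF sum_square_le_W])
    also have "\<dots> \<le> sqrt (2 * (exp (- (k * \<mu> * \<tau> * real n)) * W T))"
      using Wa by simp
    also have "\<dots> = sqrt (2 * W T) * sqrt (exp (- (k * \<mu> * \<tau> * real n)))"
      by (simp add: real_sqrt_mult)
    also have "sqrt (exp (- (k * \<mu> * \<tau> * real n))) = exp (- (k * \<mu> * \<tau> * real n) / 2)"
      by (rule real_sqrt_unique) (simp_all add: exp_double[symmetric])
    also have "sqrt (2 * W T) * exp (- (k * \<mu> * \<tau> * real n) / 2) \<le> sqrt (2 * W T) * exp (k * \<mu> / 2 * (T + \<tau> - t))"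
    proof -
      have "k * \<mu> / 2 * (t - T - \<tau>) \<le> k * \<mu> / 2 * (real n * \<tau>)"
        using n k_pos pos by (intro mult_left_mono) auto
      then show ?thesis by (intro mult_left_mono) (auto simp: algebra_simps W_def)
    qed
    finally have S: "e a + v a \<le> sqrt (2 * W T) * exp (k * \<mu> / 2 * (T + \<tau> - t))" .
    have "e t + v t \<le> 2 * m * (e a + v a)"
      using n by (intro window_linear_bounds(3)[OF a ea small]) (auto simp: a_def)
    also have "\<dots> \<le> 2 * m * (sqrt (2 * W T) * exp (k * \<mu> / 2 * (T + \<tau> - t)))"
      using S pos by (intro mult_left_mono) auto
    also have "k * \<mu> / 2 * (T + \<tau> - t) = k * \<mu> / 2 * (T + \<tau>) + - (k * \<mu> / 2) * t"
      by (simp add: field_simps)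
    also have "2 * m * (sqrt (2 * W T) * exp (k * \<mu> / 2 * (T + \<tau>) + - (k * \<mu> / 2) * t)) = c * exp (- (k * \<mu> / 2) * t)"
      by (simp only: c_def exp_add mult.assoc)
    also have "\<dots> \<le> (c + 1) * exp (- (k * \<mu> / 2) * t)"
      by (intro mult_right_mono) auto
    finally have "e t + v t \<le> (c + 1) * exp (- (k * \<mu> / 2) * t)" .
    moreover have "norm (x t) \<le> R"
      using small n by (intro window(1)[OF a ea]) (auto simp: a_def small_gain_def)
    ultimately show ?thesis by blast
  qed
  show thesis
    by (rule that[of "c + 1"]) (use c0 bound in auto)
qed

text \<open>
  Until time \<open>T\<close> nothing is known about the stability of the frozen trajectory \<open>z\<close>; it is only bounded, and
  the closed loop follows it to within \<open>O(k)\<close>. The margin \<open>\<epsilon>0 / 2\<close> in \<open>X_set\<close> absorbs that deviation.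
\<close>

lemma frozen_phase:
  assumes z: "plant_traj f {0..T} z (\<lambda>_. u 0)" "z 0 = x 0" and T: "0 \<le> T"
    and zR: "\<And>t. t \<in> {0..T} \<Longrightarrow> norm (z t) \<le> R - 1" and zT: "norm (z T - \<Xi> (u 0)) \<le> \<epsilon>0 / 2"
    and small: "k * (M * T * exp (2 * L * T)) < 1" "k * (M * T * (exp (2 * L * T) + \<alpha>)) \<le> \<epsilon>0 / 2"
  shows "e T \<le> \<epsilon>0"
proof -
  have small': "k * (M * (T - 0) * exp (2 * L * (T - 0))) < 1" using small(1) by simp
  have xR: "norm (x t) \<le> R" if "t \<in> {0..T}" for t
    by (rule frozen_input_comparison(1)[OF order_refl z _ small' that]) (rule zR)
  have M: "\<bar>r - g (x t)\<bar> \<le> M" if "t \<in> {0..T}" for t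
    by (rule output_error_bound[OF xR[OF that]])
  have "norm (x T - z T) \<le> k * M * (T - 0) * exp (2 * L * (T - 0))"
    by (rule frozen_input_comparison(2)[OF order_refl z _ small' _ M]) (use zR T in auto)
  moreover have "norm (\<Xi> (u 0) - \<Xi> (u T)) \<le> \<alpha> * (k * M * (T - 0))"
  proof -
    have "\<bar>u T - u 0\<bar> \<le> k * M * (T - 0)"
      by (rule u_deviation[OF order_refl _ M]) (use T in auto)
    then have "\<alpha> * \<bar>u 0 - u T\<bar> \<le> \<alpha> * (k * M * (T - 0))"
      using pos by (intro mult_left_mono) auto
    with \<Xi>_Lipschitz[OF u_range u_range, of 0 T] T show ?thesis by simp
  qed
  moreover have "k * (M * T * (exp (2 * L * T) + \<alpha>)) = k * M * (T - 0) * exp (2 * L * (T - 0)) + \<alpha> * (k * M * (T - 0))"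
    by (simp add: algebra_simps)
  moreover have "e T \<le> norm (x T - z T) + norm (z T - \<Xi> (u 0)) + norm (\<Xi> (u 0) - \<Xi> (u T))"
    unfolding e_def using norm_triangle_ineq[of "x T - z T" "z T - \<Xi> (u T)"]
      norm_triangle_ineq[of "z T - \<Xi> (u 0)" "\<Xi> (u 0) - \<Xi> (u T)"] by simp
  ultimately show ?thesis using zT small(2) by linarith
qed

text \<open>
  On \<open>[0, T]\<close> the error is bounded by continuity, and the constant is enlarged accordingly.
\<close>

lemma exponential_convergence_from_start:
  assumes T: "0 \<le> T" and eT: "e T \<le> \<epsilon>0" and small: "small_gain k"
  obtains C where "0 < C"
    "\<forall>t\<ge>0. norm (x t - \<Xi> ur) + \<bar>u t - ur\<bar> + \<bar>g (x t) - r\<bar> \<le> C * exp (- (k * \<mu> / 2) * t)"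
proof -
  define h where "h t = norm (x t - \<Xi> ur) + \<bar>u t - ur\<bar> + \<bar>g (x t) - r\<bar>" for t
  define \<omega> where "\<omega> = k * \<mu> / 2"
  have \<omega>: "\<omega> > 0" using k_pos pos by (simp add: \<omega>_def)
  obtain c where c: "0 < c" "\<forall>t\<ge>T. norm (x t) \<le> R \<and> e t + v t \<le> c * exp (- \<omega> * t)"
    unfolding \<omega>_def by (rule exponential_convergence[OF T eT small])
  have "continuous_on {0..T} h"
    unfolding h_def
    by (intro continuous_intros u_cont continuous_on_subset[OF x_cont] continuous_on_subset[OF gx_cont]) auto
  then have "\<exists>q\<in>{0..T}. \<forall>s\<in>{0..T}. h s \<le> h q"
    using T by (intro continuous_attains_sup) auto
  then obtain q where q: "\<forall>s\<in>{0..T}. h s \<le> h q" by blast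
  define C1 where "C1 = (\<alpha> + 2 + D) * c"
  define C2 where "C2 = h q * exp (\<omega> * T)"
  have D0: "0 < D" using Lg_pos pos by (simp add: D_def)
  have C: "0 < C1" "0 \<le> C2"
    using c(1) D0 pos by (auto simp: C1_def C2_def h_def)
  have "h t \<le> (C1 + C2) * exp (- \<omega> * t)" if "0 \<le> t" for t
  proof (cases "t \<le> T")
    case True
    have "h t \<le> h q * 1" using q True that by simp
    also have "\<dots> \<le> h q * exp (\<omega> * T + - \<omega> * t)"
      using True \<omega> by (intro mult_left_mono) (auto simp: h_def)
    also have "\<dots> = C2 * exp (- \<omega> * t)" by (simp only: C2_def exp_add mult.assoc)
    also have "\<dots> \<le> (C1 + C2) * exp (- \<omega> * t)"
      using C by (intro mult_right_mono) auto
    finally show ?thesis .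
  next
    case False
    then have xR: "norm (x t) \<le> R" and ev: "e t + v t \<le> c * exp (- \<omega> * t)" using c(2) by auto
    have "norm (x t - \<Xi> ur) \<le> e t + \<alpha> * v t"
      using state_error_le[OF u_range[OF that], of "x t"] by (simp add: e_def v_def)
    moreover have "\<bar>g (x t) - r\<bar> \<le> D * (e t + v t)"
      using output_error_le[OF xR u_range[OF that]] by (simp add: e_def v_def abs_minus_commute)
    moreover have "0 \<le> e t" "0 \<le> \<alpha> * e t" "0 \<le> v t" using e_v_nonneg pos by auto
    ultimately have "h t \<le> (\<alpha> + 2 + D) * (e t + v t)"
      unfolding h_def v_def[symmetric] by (simp add: algebra_simps)
    also have "\<dots> \<le> (\<alpha> + 2 + D) * (c * exp (- \<omega> * t))"
      using ev pos D0 by (intro mult_left_mono) auto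
    also have "\<dots> = C1 * exp (- \<omega> * t)" by (simp add: C1_def)
    also have "\<dots> \<le> (C1 + C2) * exp (- \<omega> * t)"
      using C by (intro mult_right_mono) auto
    finally show ?thesis .
  qed
  with C show thesis
    by (intro that[of "C1 + C2"]) (auto simp: h_def \<omega>_def)
qed

end

section \<open>Convergence of the closed loop\<close>

lemma equilibrium_input:
  fixes \<Xi> :: "real \<Rightarrow> 'a::real_normed_vector"
  assumes A2: "assumption2 f g umin umax \<alpha> \<Xi> \<epsilon>0 lam m \<mu>" and g: "continuous_on UNIV g"
    and r: "r \<in> {g (\<Xi> umin)<..<g (\<Xi> umax)}"
    and ur: "ur = the_inv_into {umin..umax} (\<lambda>u. g (\<Xi> u)) r"
  shows "ur \<in> {umin..umax}" "g (\<Xi> ur) = r"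
proof -
  have A1: "umin < umax" "\<alpha>-lipschitz_on {umin..umax} \<Xi>" "\<mu> > 0"
    and mono: "\<forall>u1\<in>{umin..umax}. \<forall>u2\<in>{umin..umax}. u1 > u2 \<longrightarrow> g (\<Xi> u1) - g (\<Xi> u2) \<ge> 2 * \<mu> * (u1 - u2)"
    using A2 by (auto simp: assumption2_def assumption1_def)
  have lt: "g (\<Xi> s) < g (\<Xi> t)" if "s \<in> {umin..umax}" "t \<in> {umin..umax}" "s < t" for s t
    using mono[rule_format, OF that(2,1,3)] mult_pos_pos[of "2 * \<mu>" "t - s"] \<open>\<mu> > 0\<close> that(3) by linarith
  have inj: "inj_on (\<lambda>u. g (\<Xi> u)) {umin..umax}"
  proof (rule inj_onI)
    fix s t assume "s \<in> {umin..umax}" "t \<in> {umin..umax}" "g (\<Xi> s) = g (\<Xi> t)"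
    then show "s = t" using lt[of s t] lt[of t s] by (cases s t rule: linorder_cases) auto
  qed
  have "continuous_on {umin..umax} (\<lambda>u. g (\<Xi> u))"
    by (rule continuous_on_compose2[OF g lipschitz_on_continuous_on[OF A1(2)]]) simp
  then obtain w where w: "umin \<le> w" "w \<le> umax" "g (\<Xi> w) = r"
    using IVT'[of "\<lambda>u. g (\<Xi> u)" umin r umax] r A1(1) by auto
  have "ur = w"
    unfolding ur using the_inv_into_f_f[OF inj, of w] w by simp
  with w show "ur \<in> {umin..umax}" "g (\<Xi> ur) = r" by auto
qed

lemma compact_equilibrium_tube:
  fixes \<Xi> :: "real \<Rightarrow> 'a::euclidean_space"
  assumes "continuous_on {a..b} \<Xi>"
  shows "compact {(y, w). w \<in> {a..b} \<and> norm (y - \<Xi> w) \<le> \<epsilon>}"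
proof -
  have "{(y, w). w \<in> {a..b} \<and> norm (y - \<Xi> w) \<le> \<epsilon>} = (\<lambda>(d, w). (\<Xi> w + d, w)) ` (cball 0 \<epsilon> \<times> {a..b})"
    by (force simp: image_iff intro: exI[of _ "_ - \<Xi> _"])
  moreover have "continuous_on (cball 0 \<epsilon> \<times> {a..b}) (\<lambda>(d, w). (\<Xi> w + d, w))"
    unfolding case_prod_unfold
    by (intro continuous_intros continuous_on_compose2[OF assms]) auto
  ultimately show ?thesis
    by (simp add: compact_continuous_image compact_Times)
qed

theorem mainTheorem2:
  fixes f :: "real ^ 'n \<Rightarrow> real \<Rightarrow> real ^ 'n"
    and g :: "real ^ 'n \<Rightarrow> real"
    and \<Xi> :: "real \<Rightarrow> real ^ 'n"
    and umin umax \<alpha> \<epsilon>0 lam m \<mu> k0 r ur T :: real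
  assumes f_C1: "C1_map (\<lambda>(x, u). f x u)"
    and g_C1: "C1_map g"
    and A2: "assumption2 f g umin umax \<alpha> \<Xi> \<epsilon>0 lam m \<mu>"
    and backward: "\<And>x0 u0. u0 \<in> {umin..umax} \<Longrightarrow>
          \<exists>x. plant_traj f {..0} x (\<lambda>_. u0) \<and> x 0 = x0"
    and A3: "assumption3 f g umin umax \<Xi> k0"
    and r: "r \<in> {g (\<Xi> umin)<..<g (\<Xi> umax)}"
    and ur: "ur = the_inv_into {umin..umax} (\<lambda>u. g (\<Xi> u)) r"
    and T: "T > 0"
  shows "\<exists>kT\<in>{0<..k0}. \<forall>k\<in>{0<..kT}. \<forall>x u.
           closed_loop_traj f g umin umax k r x u \<and>
           (x 0, u 0) \<in> X_set f umin umax \<Xi> \<epsilon>0 T \<longrightarrow>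
             (x \<longlongrightarrow> \<Xi> ur) at_top \<and>
             (u \<longlongrightarrow> ur) at_top \<and>
             ((\<lambda>t. g (x t)) \<longlongrightarrow> r) at_top \<and>
             (\<exists>C>0. \<exists>\<omega>>0. \<forall>t\<ge>0.
                norm (x t - \<Xi> ur) + \<bar>u t - ur\<bar> + \<bar>g (x t) - r\<bar> \<le> C * exp (- \<omega> * t))"
proof -
  have A1: "\<alpha>-lipschitz_on {umin..umax} \<Xi>" "\<epsilon>0 > 0" "lam > 0" "m \<ge> 1" "\<mu> > 0"
    using A2 by (auto simp: assumption2_def assumption1_def)
  have k0: "k0 > 0" using A3 by (simp add: assumption3_def)
  obtain g' where "\<forall>z. (g has_derivative blinfun_apply (g' z)) (at z)"
    using g_C1 unfolding C1_map_def by blast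
  then have g_cont: "continuous_on UNIV g"
    by (intro continuous_at_imp_continuous_on ballI has_derivative_continuous) blast
  have \<Xi>_cont: "continuous_on {umin..umax} \<Xi>"
    by (rule lipschitz_on_continuous_on[OF A1(1)])

  define K where "K = {(y, w). w \<in> {umin..umax} \<and> norm (y - \<Xi> w) \<le> \<epsilon>0 / 2}"
  have K: "compact K" unfolding K_def by (rule compact_equilibrium_tube[OF \<Xi>_cont])
  obtain RT where RT: "\<forall>z u0. plant_traj f {0..T} z (\<lambda>_. u0) \<and> (z T, u0) \<in> K \<longrightarrow> (\<forall>t\<in>{0..T}. norm (z t) \<le> RT)"
    by (rule trajectories_into_compact_set_bounded[OF f_C1 less_imp_le[OF T] K])
      (use backward in \<open>auto simp: K_def\<close>)
  have "bounded (\<Xi> ` {umin..umax})"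
    by (intro compact_imp_bounded compact_continuous_image \<Xi>_cont) simp
  then obtain B where B: "\<forall>p\<in>\<Xi> ` {umin..umax}. norm p \<le> B"
    unfolding bounded_iff by (elim exE) (rule that)
  \<comment> \<open>Large enough both for the tube around the equilibria and for the frozen trajectories on \<open>[0, T]\<close>.\<close>
  define R where "R = max (B + m * \<epsilon>0 + 1) (RT + 1)"
  obtain L where L: "L > 0"
    "\<forall>p q s t. norm p \<le> R \<and> norm q \<le> R \<and> s \<in> {umin..umax} \<and> t \<in> {umin..umax} \<longrightarrow>
       norm (f p s - f q t) \<le> L * (norm (p - q) + \<bar>s - t\<bar>)"
    by (rule vector_field_Lipschitz[OF f_C1])
  obtain Lg where Lg: "Lg > 0" "Lg-lipschitz_on (cball 0 R) g"
    by (rule C1_map_Lipschitz_on_compact_convex[OF g_C1 compact_cball convex_cball])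
  \<comment> \<open>This makes \<open>m * exp (- lam * \<tau>)\<close> equal to 1/4; it is positive since \<open>m \<ge> 1\<close>.\<close>
  define \<tau> where "\<tau> = ln (4 * m) / lam"
  have \<tau>: "\<tau> > 0" "m * exp (- lam * \<tau>) = 1 / 4"
    using A1(3,4) by (auto simp: \<tau>_def exp_minus)

  interpret tube f g \<Xi> umin umax \<alpha> \<epsilon>0 lam m \<mu> r ur R L Lg \<tau>
  proof
    show "norm (\<Xi> w) + m * \<epsilon>0 + 1 \<le> R" if "w \<in> {umin..umax}" for w
    proof -
      have "norm (\<Xi> w) \<le> B" using B that by blast
      then show ?thesis unfolding R_def by linarith
    qed
    show "\<bar>g p - g q\<bar> \<le> Lg * norm (p - q)" if "norm p \<le> R" "norm q \<le> R" for p q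
      using lipschitz_onD[OF Lg(2), of p q] that by (simp add: dist_norm)
  qed (use A2 g_cont equilibrium_input[OF A2 g_cont r ur] L Lg(1) \<tau> in auto)

  have "\<forall>\<^sub>F k in at_right 0. small_gain k \<and> k * (M * T * exp (2 * L * T)) < 1 \<and>
      k * (M * T * (exp (2 * L * T) + \<alpha>)) < \<epsilon>0 / 2"
    using A1(2) by (intro eventually_conj eventually_small_gain eventually_at_right_times_less) auto
  then obtain b where b: "b > 0" "\<forall>k>0. k < b \<longrightarrow> small_gain k \<and> k * (M * T * exp (2 * L * T)) < 1 \<and>
      k * (M * T * (exp (2 * L * T) + \<alpha>)) < \<epsilon>0 / 2"
    unfolding eventually_at_right_field by blast
  have conv: "(x \<longlongrightarrow> \<Xi> ur) at_top \<and> (u \<longlongrightarrow> ur) at_top \<and> ((\<lambda>t. g (x t)) \<longlongrightarrow> r) at_top \<and>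
      (\<exists>C>0. \<exists>\<omega>>0. \<forall>t\<ge>0. norm (x t - \<Xi> ur) + \<bar>u t - ur\<bar> + \<bar>g (x t) - r\<bar> \<le> C * exp (- \<omega> * t))"
    if k: "0 < k" "k < b" and loop: "closed_loop_traj f g umin umax k r x u"
      and init: "(x 0, u 0) \<in> X_set f umin umax \<Xi> \<epsilon>0 T" for k x u
  proof -
    interpret closed_loop f g \<Xi> umin umax \<alpha> \<epsilon>0 lam m \<mu> r ur R L Lg \<tau> k x u
      by unfold_locales (use loop k in auto)
    have small: "small_gain k" "k * (M * T * exp (2 * L * T)) < 1"
      "k * (M * T * (exp (2 * L * T) + \<alpha>)) \<le> \<epsilon>0 / 2"
      using b(2)[rule_format, OF k] by auto
    obtain z where z: "plant_traj f {0..T} z (\<lambda>_. u 0)" "z 0 = x 0" "norm (z T - \<Xi> (u 0)) \<le> \<epsilon>0 / 2"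
      and u0: "u 0 \<in> {umin..umax}"
      using init unfolding X_set_def by blast
    have "e T \<le> \<epsilon>0"
    proof (rule frozen_phase[OF z(1,2) _ _ z(3) small(2,3)])
      show "norm (z t) \<le> R - 1" if "t \<in> {0..T}" for t
      proof -
        have "norm (z t) \<le> RT" using RT z(1,3) u0 that by (auto simp: K_def)
        then show ?thesis by (simp add: R_def)
      qed
    qed (use T in simp)
    with T small(1) obtain C where C: "C > 0"
      "\<forall>t\<ge>0. norm (x t - \<Xi> ur) + \<bar>u t - ur\<bar> + \<bar>g (x t) - r\<bar> \<le> C * exp (- (k * \<mu> / 2) * t)"
      using exponential_convergence_from_start[of T] by (metis less_imp_le)
    have \<omega>: "k * \<mu> / 2 > 0" using k A1(5) by simp
    have "filterlim (\<lambda>t. - (k * \<mu> / 2) * t) at_bot at_top"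
      by (rule filterlim_tendsto_neg_mult_at_bot[OF tendsto_const _ filterlim_ident]) (use \<omega> in simp)
    then have lim0: "((\<lambda>t. C * exp (- (k * \<mu> / 2) * t)) \<longlongrightarrow> 0) at_top"
      by (intro tendsto_mult_right_zero filterlim_compose[OF exp_at_bot])
    have to_limit: "(p \<longlongrightarrow> l) at_top"
      if "\<forall>t\<ge>0. dist (p t) l \<le> C * exp (- (k * \<mu> / 2) * t)" for p :: "real \<Rightarrow> 'c::metric_space" and l
    proof (rule metric_tendsto_imp_tendsto[OF lim0])
      show "\<forall>\<^sub>F t in at_top. dist (p t) l \<le> dist (C * exp (- (k * \<mu> / 2) * t)) 0"
        by (rule eventually_mono[OF eventually_ge_at_top[of "0 :: real"]]) (use that C(1) in simp)
    qed
    have each: "norm (x t - \<Xi> ur) \<le> C * exp (- (k * \<mu> / 2) * t) \<and> \<bar>u t - ur\<bar> \<le> C * exp (- (k * \<mu> / 2) * t) \<and>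
        \<bar>g (x t) - r\<bar> \<le> C * exp (- (k * \<mu> / 2) * t)" if "0 \<le> t" for t
      using C(2)[rule_format, OF that] norm_ge_zero[of "x t - \<Xi> ur"] by linarith
    show ?thesis
    proof (intro conjI)
      show "(x \<longlongrightarrow> \<Xi> ur) at_top" "(u \<longlongrightarrow> ur) at_top" "((\<lambda>t. g (x t)) \<longlongrightarrow> r) at_top"
        by (rule to_limit, use each in \<open>simp add: dist_norm\<close>)+
      show "\<exists>C>0. \<exists>\<omega>>0. \<forall>t\<ge>0. norm (x t - \<Xi> ur) + \<bar>u t - ur\<bar> + \<bar>g (x t) - r\<bar> \<le> C * exp (- \<omega> * t)"
        by (intro exI[of _ C] exI[of _ "k * \<mu> / 2"] conjI C \<omega>)
    qed
  qed
  show ?thesis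
  \<comment> \<open>The half keeps \<open>k\<close> strictly below \<open>b\<close>.\<close>
  proof (intro bexI[of _ "min k0 (b / 2)"] ballI allI impI)
    fix k x u
    assume "k \<in> {0<..min k0 (b / 2)}"
    then have "0 < k" "k < b" using b(1) by auto
    moreover assume "closed_loop_traj f g umin umax k r x u \<and> (x 0, u 0) \<in> X_set f umin umax \<Xi> \<epsilon>0 T"
    ultimately show "(x \<longlongrightarrow> \<Xi> ur) at_top \<and> (u \<longlongrightarrow> ur) at_top \<and> ((\<lambda>t. g (x t)) \<longlongrightarrow> r) at_top \<and>
        (\<exists>C>0. \<exists>\<omega>>0. \<forall>t\<ge>0. norm (x t - \<Xi> ur) + \<bar>u t - ur\<bar> + \<bar>g (x t) - r\<bar> \<le> C * exp (- \<omega> * t))"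
      using conv by blast
  qed (use b(1) k0 in auto)
qed

end
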